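(* Let $J_0>1$ and $\mu>0$, and consider the two-dimensional compressible Hadamard material with stored energy $W(\boldsymbol F)=\frac{\mu}{2}\operatorname{tr}(\boldsymbol F^\top\boldsymbol F)+h(\det\boldsymbol F)$, $h(J)=\frac{1}{4J_0}\big((J_0-J)^2-1\big)^2$, and the static phase boundary $(\underline{\boldsymbol F}^{\pm},\boldsymbol 0,0,\hat{\boldsymbol e}_1)$ described in the context, with kinetic rule given by the Abeyaratne–Knowles rule $\tilde g=-\varepsilon s$, $\varepsilon>0$. Set $$\delta_1:=1-\frac{4}{27J_0^2\mu^2}-\frac{4}{9\mu^2},\qquad \mu_*:=\frac23\sqrt{1+\frac{1}{3J_0^2}}.$$ (i) If $\mu>\mu_*$, which amounts to $\delta_1>0$, then the phase boundary is uniformly stable for all $\varepsilon>0$. (ii) If $\mu=\mu_*$, which amounts to $\delta_1=0$, then the phase boundary is weakly stable for all $\varepsilon>0$. (iii) If $0<\mu<\mu_*$, which amounts to $\delta_1<0$, then the phase boundary is strongly unstable for all $\varepsilon>0$.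
   Context: Material. For $\boldsymbol F\in\mathbb R^{2\times2}$ with $\det\boldsymbol F>0$ let $\boldsymbol\sigma(\boldsymbol F)=\partial W/\partial\boldsymbol F$; $\boldsymbol F_j$, $\boldsymbol\sigma(\boldsymbol F)_j$ denote $j$-th columns, and $\boldsymbol B_i^j(\boldsymbol F)=\partial\boldsymbol\sigma_j/\partial\boldsymbol F_i\in\mathbb R^{2\times2}$, with $(k,l)$ entry $\partial^2W/\partial F_{kj}\partial F_{li}$. $\hat{\boldsymbol e}_1,\hat{\boldsymbol e}_2$ is the canonical basis of $\mathbb R^2$ and $\mathbf I_2$ the identity. Phase boundary. With $\theta_0=\frac{3\mu J_0}{2}$, put $\underline{\boldsymbol F}^{\pm}=\operatorname{diag}\big((J_0\pm\frac1{\sqrt3})\frac{1}{\sqrt{\theta_0}},\ \sqrt{\theta_0}\big)$. The phase boundary $(\underline{\boldsymbol F}^{\pm},\boldsymbol 0,0,\hat{\boldsymbol e}_1)$ is the static weak solution $(\boldsymbol F,\boldsymbol v)=(\underline{\boldsymbol F}^-,\boldsymbol0)$ for $x_1<0$, $(\underline{\boldsymbol F}^+,\boldsymbol0)$ for $x_1>0$, of the elastodynamics system $\boldsymbol F_t-\nabla_x\boldsymbol v=0$, $\boldsymbol v_t-\operatorname{div}_x\boldsymbol\sigma(\boldsymbol F)=0$, $\operatorname{curl}_x\boldsymbol F=0$ in $\mathbb R^2$ (speed $s=0$, normal $\boldsymbol n=\hat{\boldsymbol e}_1$). Write $[\![a]\!]=a^+-a^-$ and $\langle a\rangle=\frac12(a^++a^-)$.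 Kinetic rule. This is an extra jump condition $g\big((\boldsymbol F^-,\boldsymbol v^-),(\boldsymbol F^+,\boldsymbol v^+),s,\boldsymbol n\big)=0$ with $g=[\![W]\!]-\boldsymbol n^\top[\![\boldsymbol F]\!]^\top\langle\boldsymbol\sigma(\boldsymbol F)\rangle\boldsymbol n+\tilde g$. Here $\tilde g=-\varepsilon s$ with a constant $\varepsilon>0$. Lopatinskiĭ determinant. Let $\Gamma=\{(\lambda,\xi)\in\mathbb C\times\mathbb R:\ |\lambda|^2+|\xi|^2=1,\ \operatorname{Re}\lambda\ge0\}$ and $\Gamma^+=\Gamma\cap\{\operatorname{Re}\lambda>0\}$. With superscripts $\pm$ denoting evaluation at $\underline{\boldsymbol F}^\pm$, define $$\mathcal M_\pm=\begin{pmatrix} \mathrm i\xi(\boldsymbol B_1^{1\pm})^{-1}\boldsymbol B_2^{1\pm} & -(\boldsymbol B_1^{1\pm})^{-1}\\ \xi^2\boldsymbol B_1^{2\pm}(\boldsymbol B_1^{1\pm})^{-1}\boldsymbol B_2^{1\pm}-\lambda^2\mathbf I_2-\xi^2\boldsymbol B_2^{2\pm} & \mathrm i\xi\boldsymbol B_1^{2\pm}(\boldsymbol B_1^{1\pm})^{-1}\end{pmatrix}\in\mathbb C^{4\times4},$$ $$\mathcal K_\pm=\begin{pmatrix}\mathrm i\xi(\boldsymbol B_1^{1\pm})^{-1}\boldsymbol B_2^{1\pm}&-(\boldsymbol B_1^{1\pm})^{-1}\\-\mathrm i\xi\mathbf I_2&0\\-\lambda\mathbf I_2&0\end{pmatrix}\in\mathbb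 C^{6\times4}.$$ For $(\lambda,\xi)\in\Gamma^+$, $\widetilde{\mathcal R}^s_-$ (resp. $\widetilde{\mathcal R}^u_+$) is the $4\times2$ matrix whose columns form the basis of the stable invariant subspace of $\mathcal M_-$ (eigenvalues with negative real part), resp. the unstable invariant subspace of $\mathcal M_+$ (eigenvalues with positive real part), normalized so that its upper $2\times2$ block is $\mathbf I_2$; both are extended continuously to $\Gamma$. Put $$\widehat{\mathcal Q}=\begin{pmatrix}[\![\boldsymbol F_1]\!]\\-\mathrm i\xi[\![\boldsymbol\sigma(\boldsymbol F)_2]\!]\end{pmatrix},\quad \widehat q=-\lambda D_sg+\mathrm i\xi\,\hat{\boldsymbol e}_2\cdot D_{\boldsymbol n}g,$$ $$\widetilde p^+=(D_{(\boldsymbol F^+,\boldsymbol v^+)}g)\mathcal K_+\widetilde{\mathcal R}^u_+,\quad \widetilde p^-=-(D_{(\boldsymbol F^-,\boldsymbol v^-)}g)\mathcal K_-\widetilde{\mathcal R}^s_-,$$ where derivatives of $g$ are evaluated at $\big((\underline{\boldsymbol F}^-,\boldsymbol0),(\underline{\boldsymbol F}^+,\boldsymbol0),0,\hat{\boldsymbol e}_1\big)$ and $D_{(\boldsymbol F^\pm,\boldsymbol v^\pm)}g\in\mathbb R^{1\times6}$ is ordered as $(\boldsymbol F_1,\boldsymbol F_2,\boldsymbol v)$. The Lopatinskiĭ determinant is $$\Delta(\lambda,\xi)=\det\begin{pmatrix}\widetilde{\mathcal R}^s_-&\widehat{\mathcal Q}&\widetilde{\mathcal R}^u_+\\ \widetilde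 p^-&\widehat q&\widetilde p^+\end{pmatrix},\qquad(\lambda,\xi)\in\Gamma.$$ Stability notions. The phase boundary is: weakly stable if $\Delta$ has no zero in $\Gamma^+$; uniformly stable if $\Delta$ has no zero in $\Gamma$; strongly unstable if $\Delta$ has a zero in $\Gamma^+$. *)

theory Defs
  imports "HOL-Analysis.Analysis"
begin

text \<open>Matrices are indexed as \<open>F $ row $ column\<close>; \<open>axis k (axis j 1)\<close> is the matrix unit
  with entry 1 at position \<open>(k, j)\<close>.\<close>

section \<open>Stored energy, stress and elasticity blocks\<close>

definition hadamard_h :: "real \<Rightarrow> real \<Rightarrow> real" where
  "hadamard_h J\<^sub>0 J = 1 / (4 * J\<^sub>0) * ((J\<^sub>0 - J)\<^sup>2 - 1)\<^sup>2"

text \<open>Only values near deformation gradients of positive determinant matter; the formula makes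
  sense for every matrix, so no domain restriction is built in.\<close>

definition hadamard_energy :: "real \<Rightarrow> real \<Rightarrow> real^2^2 \<Rightarrow> real" where
  "hadamard_energy J\<^sub>0 \<mu> F = \<mu> / 2 * trace (transpose F ** F) + hadamard_h J\<^sub>0 (det F)"

definition stress :: "(real^2^2 \<Rightarrow> real) \<Rightarrow> real^2^2 \<Rightarrow> real^2^2" where
  "stress W F = (\<chi> k j. frechet_derivative W (at F) (axis k (axis j 1)))"

text \<open>\<open>elasticity W i j F\<close> is \<open>B\<^sub>i\<^sup>j(F)\<close>: lower index (column of \<open>F\<close>) first, upper index
  (column of the stress) second.\<close>

definition elasticity :: "(real^2^2 \<Rightarrow> real) \<Rightarrow> 2 \<Rightarrow> 2 \<Rightarrow> real^2^2 \<Rightarrow> real^2^2" where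
  "elasticity W i j F =
     (\<chi> k l. frechet_derivative (\<lambda>G. stress W G $ k $ j) (at F) (axis l (axis i 1)))"

section \<open>Static phase boundary with normal \<open>e\<^sub>1\<close> and kinetic rule\<close>

definition theta0 :: "real \<Rightarrow> real \<Rightarrow> real" where
  "theta0 J\<^sub>0 \<mu> = 3 * \<mu> * J\<^sub>0 / 2"

definition F_minus :: "real \<Rightarrow> real \<Rightarrow> real^2^2" where
  "F_minus J\<^sub>0 \<mu> = vector [vector [(J\<^sub>0 - 1 / sqrt 3) * (1 / sqrt (theta0 J\<^sub>0 \<mu>)), 0],
                          vector [0, sqrt (theta0 J\<^sub>0 \<mu>)]]"

definition F_plus :: "real \<Rightarrow> real \<Rightarrow> real^2^2" where
  "F_plus J\<^sub>0 \<mu> = vector [vector [(J\<^sub>0 + 1 / sqrt 3) * (1 / sqrt (theta0 J\<^sub>0 \<mu>)), 0],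
                         vector [0, sqrt (theta0 J\<^sub>0 \<mu>)]]"

type_synonym state = "(real^2^2) \<times> (real^2)"
type_synonym jump_function = "state \<Rightarrow> state \<Rightarrow> real \<Rightarrow> real^2 \<Rightarrow> real"

text \<open>The arguments are the state on the minus side, the state on the plus side, the speed and
  the normal. The normal ranges over the whole plane, so that the derivative with respect to it
  makes sense.\<close>

definition kinetic_rule :: "(real^2^2 \<Rightarrow> real) \<Rightarrow> jump_function \<Rightarrow> jump_function" where
  "kinetic_rule W gt Um Up s n =
     W (fst Up) - W (fst Um)
     - n \<bullet> (transpose (fst Up - fst Um) *v
             (((1/2) *\<^sub>R (stress W (fst Um) + stress W (fst Up))) *v n))
     + gt Um Up s n"

definition abeyaratne_knowles :: "real \<Rightarrow> jump_function" where
  "abeyaratne_knowles \<epsilon> Um Up s n = - \<epsilon> * s"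

text \<open>The row \<open>D\<^bsub>(F,v)\<^esub> f\<close> of partial derivatives, ordered as \<open>(F\<^sub>1, F\<^sub>2, v)\<close> where \<open>F\<^sub>j\<close> is
  the \<open>j\<close>-th column.\<close>

definition state_gradient :: "(state \<Rightarrow> real) \<Rightarrow> state \<Rightarrow> complex^6" where
  "state_gradient f U =
     vector (map (\<lambda>d. complex_of_real (frechet_derivative f (at U) d))
       [(axis 1 (axis 1 1), 0), (axis 2 (axis 1 1), 0),
        (axis 1 (axis 2 1), 0), (axis 2 (axis 2 1), 0),
        (0, axis 1 1), (0, axis 2 1)])"

definition normal_gradient :: "(real^2 \<Rightarrow> real) \<Rightarrow> real^2 \<Rightarrow> real^2" where
  "normal_gradient f n = (\<chi> k. frechet_derivative f (at n) (axis k 1))"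

section \<open>The matrices \<open>\<M>\<close> and \<open>\<K>\<close>\<close>

definition \<Gamma> :: "(complex \<times> real) set" where
  "\<Gamma> = {(lam, \<xi>). (cmod lam)\<^sup>2 + \<bar>\<xi>\<bar>\<^sup>2 = 1 \<and> Re lam \<ge> 0}"

definition \<Gamma>_plus :: "(complex \<times> real) set" where
  "\<Gamma>_plus = \<Gamma> \<inter> {(lam, \<xi>). Re lam > 0}"

definition block_row :: "complex^2^2 \<Rightarrow> complex^2^2 \<Rightarrow> (complex^4) list" where
  "block_row X Y = [vector [X$1$1, X$1$2, Y$1$1, Y$1$2],
                    vector [X$2$1, X$2$2, Y$2$1, Y$2$2]]"

definition M_matrix :: "(real^2^2 \<Rightarrow> real) \<Rightarrow> real^2^2 \<Rightarrow> complex \<Rightarrow> real \<Rightarrow> complex^4^4" where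
  "M_matrix W F lam \<xi> =
     (let B = (\<lambda>i j. map_matrix complex_of_real (elasticity W i j F));
          Binv = matrix_inv (B 1 1);
          x = complex_of_real \<xi>
      in vector
        (block_row (mat (\<i> * x) ** (Binv ** B 2 1))
                   (- Binv) @
         block_row (mat (x\<^sup>2) ** (B 1 2 ** Binv ** B 2 1) - mat (lam\<^sup>2) - mat (x\<^sup>2) ** B 2 2)
                   (mat (\<i> * x) ** (B 1 2 ** Binv))))"

definition K_matrix :: "(real^2^2 \<Rightarrow> real) \<Rightarrow> real^2^2 \<Rightarrow> complex \<Rightarrow> real \<Rightarrow> complex^4^6" where
  "K_matrix W F lam \<xi> =
     (let B = (\<lambda>i j. map_matrix complex_of_real (elasticity W i j F));
          Binv = matrix_inv (B 1 1);
          x = complex_of_real \<xi>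
      in vector
        (block_row (mat (\<i> * x) ** (Binv ** B 2 1)) (- Binv) @
         block_row (- mat (\<i> * x)) 0 @
         block_row (- mat lam) 0))"

section \<open>Invariant subspaces and their normalized bases\<close>

text \<open>The complex span of all generalized eigenvectors belonging to the eigenvalues that
  satisfy \<open>P\<close>. (For other complex numbers the generalized eigenspace is zero.)\<close>

definition spectral_subspace :: "(complex \<Rightarrow> bool) \<Rightarrow> complex^4^4 \<Rightarrow> (complex^4) set" where
  "spectral_subspace P M =
     vec.span {u. \<exists>z k. P z \<and> ((\<lambda>y. (M - mat z) *v y) ^^ k) u = 0}"

definition stable_subspace :: "complex^4^4 \<Rightarrow> (complex^4) set" where
  "stable_subspace = spectral_subspace (\<lambda>z. Re z < 0)"

definition unstable_subspace :: "complex^4^4 \<Rightarrow> (complex^4) set" where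
  "unstable_subspace = spectral_subspace (\<lambda>z. Re z > 0)"

definition normalized_basis :: "(complex^4) set \<Rightarrow> complex^2^4" where
  "normalized_basis V =
     (THE R. vec.independent (columns R) \<and> vec.span (columns R) = V \<and>
             R$1$1 = 1 \<and> R$1$2 = 0 \<and> R$2$1 = 0 \<and> R$2$2 = 1)"

text \<open>Continuous extension from \<open>\<Gamma>_plus\<close> to \<open>\<Gamma>\<close>.\<close>

definition extend_to_\<Gamma> :: "(complex \<times> real \<Rightarrow> 'a::t2_space) \<Rightarrow> complex \<times> real \<Rightarrow> 'a" where
  "extend_to_\<Gamma> f p = (if p \<in> \<Gamma>_plus then f p else Lim (at p within \<Gamma>_plus) f)"

definition R_stable :: "(real^2^2 \<Rightarrow> real) \<Rightarrow> real^2^2 \<Rightarrow> complex \<times> real \<Rightarrow> complex^2^4" where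
  "R_stable W F = extend_to_\<Gamma> (\<lambda>(lam, \<xi>). normalized_basis (stable_subspace (M_matrix W F lam \<xi>)))"

definition R_unstable :: "(real^2^2 \<Rightarrow> real) \<Rightarrow> real^2^2 \<Rightarrow> complex \<times> real \<Rightarrow> complex^2^4" where
  "R_unstable W F = extend_to_\<Gamma> (\<lambda>(lam, \<xi>). normalized_basis (unstable_subspace (M_matrix W F lam \<xi>)))"

section \<open>Lopatinskii determinant and stability\<close>

text \<open>In all of the following, \<open>W\<close> is the stored energy, \<open>gt\<close> the additional term of the kinetic
  rule, and \<open>Fm\<close>, \<open>Fp\<close> are the deformation gradients of a static phase boundary with zero
  velocities, speed 0 and normal \<open>e\<^sub>1 = axis 1 1\<close>.\<close>

definition Q_hat :: "(real^2^2 \<Rightarrow> real) \<Rightarrow> real^2^2 \<Rightarrow> real^2^2 \<Rightarrow> real \<Rightarrow> complex^4" where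
  "Q_hat W Fm Fp \<xi> =
     (let JF = column 1 Fp - column 1 Fm;
          JS = column 2 (stress W Fp) - column 2 (stress W Fm)
      in vector [complex_of_real (JF$1), complex_of_real (JF$2),
                 - \<i> * complex_of_real \<xi> * complex_of_real (JS$1),
                 - \<i> * complex_of_real \<xi> * complex_of_real (JS$2)])"

definition q_hat ::
  "(real^2^2 \<Rightarrow> real) \<Rightarrow> jump_function \<Rightarrow> real^2^2 \<Rightarrow> real^2^2 \<Rightarrow> complex \<Rightarrow> real \<Rightarrow> complex" where
  "q_hat W gt Fm Fp lam \<xi> =
     (let g = kinetic_rule W gt
      in - lam * complex_of_real (deriv (\<lambda>s. g (Fm, 0) (Fp, 0) s (axis 1 1)) 0)
         + \<i> * complex_of_real \<xi> *
           complex_of_real (axis 2 1 \<bullet> normal_gradient (\<lambda>n. g (Fm, 0) (Fp, 0) 0 n) (axis 1 1)))"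

definition p_plus ::
  "(real^2^2 \<Rightarrow> real) \<Rightarrow> jump_function \<Rightarrow> real^2^2 \<Rightarrow> real^2^2 \<Rightarrow> complex \<Rightarrow> real \<Rightarrow> complex^2" where
  "p_plus W gt Fm Fp lam \<xi> =
     state_gradient (\<lambda>U. kinetic_rule W gt (Fm, 0) U 0 (axis 1 1)) (Fp, 0)
       v* (K_matrix W Fp lam \<xi> ** R_unstable W Fp (lam, \<xi>))"

definition p_minus ::
  "(real^2^2 \<Rightarrow> real) \<Rightarrow> jump_function \<Rightarrow> real^2^2 \<Rightarrow> real^2^2 \<Rightarrow> complex \<Rightarrow> real \<Rightarrow> complex^2" where
  "p_minus W gt Fm Fp lam \<xi> =
     - (state_gradient (\<lambda>U. kinetic_rule W gt U (Fp, 0) 0 (axis 1 1)) (Fm, 0)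
          v* (K_matrix W Fm lam \<xi> ** R_stable W Fm (lam, \<xi>)))"

definition lopatinskii_determinant ::
  "(real^2^2 \<Rightarrow> real) \<Rightarrow> jump_function \<Rightarrow> real^2^2 \<Rightarrow> real^2^2 \<Rightarrow> complex \<times> real \<Rightarrow> complex" where
  "lopatinskii_determinant W gt Fm Fp = (\<lambda>(lam, \<xi>).
     let Rm = R_stable W Fm (lam, \<xi>);
         Rp = R_unstable W Fp (lam, \<xi>);
         Q = Q_hat W Fm Fp \<xi>;
         pm = p_minus W gt Fm Fp lam \<xi>;
         pp = p_plus W gt Fm Fp lam \<xi>
     in det (vector
          [vector [Rm$1$1, Rm$1$2, Q$1, Rp$1$1, Rp$1$2],
           vector [Rm$2$1, Rm$2$2, Q$2, Rp$2$1, Rp$2$2],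
           vector [Rm$3$1, Rm$3$2, Q$3, Rp$3$1, Rp$3$2],
           vector [Rm$4$1, Rm$4$2, Q$4, Rp$4$1, Rp$4$2],
           vector [pm$1, pm$2, q_hat W gt Fm Fp lam \<xi>, pp$1, pp$2]] :: complex^5^5))"

definition weakly_stable ::
  "(real^2^2 \<Rightarrow> real) \<Rightarrow> jump_function \<Rightarrow> real^2^2 \<Rightarrow> real^2^2 \<Rightarrow> bool" where
  "weakly_stable W gt Fm Fp \<longleftrightarrow> (\<forall>p\<in>\<Gamma>_plus. lopatinskii_determinant W gt Fm Fp p \<noteq> 0)"

definition uniformly_stable ::
  "(real^2^2 \<Rightarrow> real) \<Rightarrow> jump_function \<Rightarrow> real^2^2 \<Rightarrow> real^2^2 \<Rightarrow> bool" where
  "uniformly_stable W gt Fm Fp \<longleftrightarrow> (\<forall>p\<in>\<Gamma>. lopatinskii_determinant W gt Fm Fp p \<noteq> 0)"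

definition strongly_unstable ::
  "(real^2^2 \<Rightarrow> real) \<Rightarrow> jump_function \<Rightarrow> real^2^2 \<Rightarrow> real^2^2 \<Rightarrow> bool" where
  "strongly_unstable W gt Fm Fp \<longleftrightarrow> (\<exists>p\<in>\<Gamma>_plus. lopatinskii_determinant W gt Fm Fp p = 0)"

end

theory Submission
  imports Defs
begin

text \<open>At both phases \<open>h''\<close> vanishes, so \<open>B\<^sub>1\<^sup>1 = B\<^sub>2\<^sup>2 = \<mu> I\<close> and \<open>B\<^sub>2\<^sup>1 = - B\<^sub>1\<^sup>2\<close> is a multiple of the rotation
  by a right angle. Hence \<open>\<M>\<^sup>2 = w\<^sup>2 I\<close> with \<open>w\<^sup>2 = lam\<^sup>2/\<mu> + \<xi>\<^sup>2\<close>, the stable and unstable subspaces are the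
  eigenspaces of \<open>-w\<close> and \<open>w\<close>, and up to a positive factor the Lopatinskii determinant is
  \<open>\<epsilon> lam (\<mu> lam\<^sup>2 + A \<xi>\<^sup>2) + k w (\<mu> lam\<^sup>2 + (A - 4/9) \<xi>\<^sup>2)\<close> with \<open>k > 0\<close>, \<open>A < \<mu>\<^sup>2\<close> and
  \<open>A - 4/9 = \<mu>\<^sup>2 \<delta>\<^sub>1\<close>. For \<open>\<delta>\<^sub>1 \<ge> 0\<close> comparing the arguments of the two summands rules out zeros
  with \<open>Re lam > 0\<close>; for \<open>\<delta>\<^sub>1 > 0\<close> the summands cannot cancel on the imaginary axis either. For
  \<open>\<delta>\<^sub>1 < 0\<close> the intermediate value theorem yields a zero with real \<open>lam > 0\<close>.\<close>

section \<open>Vectors, matrices and spectral subspaces\<close>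

lemma vector_4 [simp]:
  "(vector [a,b,c,d] :: ('a::zero)^4) $ 1 = a"
  "(vector [a,b,c,d] :: ('a::zero)^4) $ 2 = b"
  "(vector [a,b,c,d] :: ('a::zero)^4) $ 3 = c"
  "(vector [a,b,c,d] :: ('a::zero)^4) $ 4 = d"
  unfolding vector_def by simp_all

lemma vector_5 [simp]:
  "(vector [a,b,c,d,e] :: ('a::zero)^5) $ 1 = a"
  "(vector [a,b,c,d,e] :: ('a::zero)^5) $ 2 = b"
  "(vector [a,b,c,d,e] :: ('a::zero)^5) $ 3 = c"
  "(vector [a,b,c,d,e] :: ('a::zero)^5) $ 4 = d"
  "(vector [a,b,c,d,e] :: ('a::zero)^5) $ 5 = e"
  unfolding vector_def by simp_all

lemma vector_6 [simp]:
  "(vector [a,b,c,d,e,f] :: ('a::zero)^6) $ 1 = a"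
  "(vector [a,b,c,d,e,f] :: ('a::zero)^6) $ 2 = b"
  "(vector [a,b,c,d,e,f] :: ('a::zero)^6) $ 3 = c"
  "(vector [a,b,c,d,e,f] :: ('a::zero)^6) $ 4 = d"
  "(vector [a,b,c,d,e,f] :: ('a::zero)^6) $ 5 = e"
  "(vector [a,b,c,d,e,f] :: ('a::zero)^6) $ 6 = f"
  unfolding vector_def by simp_all

lemma UNIV_5: "UNIV = {1, 2, 3, 4, 5 :: 5}"
proof -
  have "x \<in> {1, 2, 3, 4, 5}" for x :: 5
  proof (induct x)
    case (of_int z)
    \<comment> \<open>The residue 0 is the element written \<open>5\<close>.\<close>
    then have "z = 0 \<or> z = 1 \<or> z = 2 \<or> z = 3 \<or> z = 4" by fastforce
    then show ?case by auto
  qed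
  then show ?thesis by blast
qed

lemma UNIV_6: "UNIV = {1, 2, 3, 4, 5, 6 :: 6}"
proof -
  have "x \<in> {1, 2, 3, 4, 5, 6}" for x :: 6
  proof (induct x)
    case (of_int z)
    then have "z = 0 \<or> z = 1 \<or> z = 2 \<or> z = 3 \<or> z = 4 \<or> z = 5" by fastforce
    then show ?case by auto
  qed
  then show ?thesis by blast
qed

lemma forall_5: "(\<forall>i::5. P i) \<longleftrightarrow> P 1 \<and> P 2 \<and> P 3 \<and> P 4 \<and> P 5"
  by (metis UNIV_5 UNIV_I insertE empty_iff)

lemma sum_5: "sum f (UNIV :: 5 set) = f 1 + f 2 + f 3 + f 4 + f 5"
  unfolding UNIV_5 by (simp add: ac_simps)

lemma sum_6: "sum f (UNIV :: 6 set) = f 1 + f 2 + f 3 + f 4 + f 5 + f 6"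
  unfolding UNIV_6 by (simp add: ac_simps)

text \<open>Lets a 5 x 5 determinant be tested for zero by solving a linear system instead of
  expanding it.\<close>

lemma det_eq_0_iff_ker:
  fixes A :: "'a::field^'n^'n"
  shows "det A = 0 \<longleftrightarrow> (\<exists>x. x \<noteq> 0 \<and> A *v x = 0)"
  using invertible_det_nz[of A] matrix_left_invertible_ker[of A] invertible_left_inverse[of A]
  by blast

lemma mat_mult_vector: "mat z *v u = z *s (u :: 'a::semiring_1^'n)"
  by (simp add: mat_def matrix_vector_mult_def vec_eq_iff if_distrib if_distribR cong: if_cong)

lemma funpow_diff_mat_eigenvector:
  fixes M :: "'a::field^'n^'n"
  assumes "M *v u = w *s u"
  shows "((\<lambda>y. (M - mat z) *v y) ^^ k) u = (w - z) ^ k *s u"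
proof (induction k)
  case (Suc k)
  have "(M - mat z) *v u = (w - z) *s u"
    using assms by (simp add: matrix_vector_mult_diff_rdistrib mat_mult_vector vec.scale_left_diff_distrib)
  then show ?case
    using Suc by (simp only: funpow.simps o_apply vec.scale vec.scale_scale power_Suc2)
qed simp

lemma funpow_matrix_add:
  fixes A :: "'a::field^'n^'n"
  shows "((\<lambda>y. A *v y) ^^ k) (u + v) = ((\<lambda>y. A *v y) ^^ k) u + ((\<lambda>y. A *v y) ^^ k) v"
  by (induction k) (simp_all add: vec.add)

text \<open>Since \<open>M\<close> squares to the nonzero scalar \<open>w\<^sup>2\<close>, every
  vector splits into an eigenvector for \<open>w\<close> and one for \<open>- w\<close>. A
  generalized eigenvector for some \<open>z\<close> with \<open>P z\<close> has no component for
  \<open>- w\<close>, because \<open>z\<close> differs from \<open>- w\<close>.\<close>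

lemma spectral_subspace_of_scalar_square:
  assumes sq: "M ** M = mat (w\<^sup>2)" and "w \<noteq> 0" "P w" "\<not> P (- w)"
  shows "spectral_subspace P M = {u. M *v u = w *s u}"
proof
  have "vec.subspace {u. M *v u = w *s u}"
    by (auto simp: vec.subspace_def vec.add vec.scale vec.scale_right_distrib vector_smult_assoc mult.commute)
  moreover have "M *v u = w *s u" if z: "P z" "((\<lambda>y. (M - mat z) *v y) ^^ k) u = 0" for u z k
  proof -
    \<comment> \<open>The projections onto the two eigenspaces are (1 + M/w)/2 and (1 -
      M/w)/2.\<close>
    define a where "a = (1/2) *s (u + (1/w) *s (M *v u))"
    define b where "b = (1/2) *s (u - (1/w) *s (M *v u))"
    have MM: "M *v (M *v u) = w\<^sup>2 *s u"
      by (simp add: matrix_vector_mul_assoc sq mat_mult_vector)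
    have Ma: "M *v a = w *s a" and Mb: "M *v b = (- w) *s b"
      using \<open>w \<noteq> 0\<close> unfolding a_def b_def vec.scale vec.add vec.diff MM
      by (simp_all add: vec_eq_iff field_simps power2_eq_square)
    have u: "u = a + b"
      by (simp add: a_def b_def vec_eq_iff field_simps)
    have 0: "(w - z) ^ k *s a + (- w - z) ^ k *s b = 0"
      using z(2) unfolding u funpow_matrix_add funpow_diff_mat_eigenvector[OF Ma]
        funpow_diff_mat_eigenvector[OF Mb] .
    \<comment> \<open>Applying \<open>M\<close> to the relation \<open>0\<close> flips the sign of
      its second term, so both terms vanish separately.\<close>
    have "w *s ((w - z) ^ k *s a) - w *s ((- w - z) ^ k *s b) = M *v ((w - z) ^ k *s a + (- w - z) ^ k *s b)"
      unfolding vec.add vec.scale Ma Mb by (simp add: vec_eq_iff)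
    also have "\<dots> = 0"
      unfolding 0 by simp
    finally have "w *s ((w - z) ^ k *s a - (- w - z) ^ k *s b) = 0"
      by (simp add: vec.scale_right_diff_distrib)
    then have "(w - z) ^ k *s a = (- w - z) ^ k *s b"
      using \<open>w \<noteq> 0\<close> by (metis vec.scale_eq_0_iff eq_iff_diff_eq_0)
    with 0 have "2 *s ((- w - z) ^ k *s b) = 0"
      by (simp add: vec_eq_iff)
    moreover have "- w - z \<noteq> 0"
      using \<open>\<not> P (- w)\<close> \<open>P z\<close> by (metis eq_iff_diff_eq_0)
    ultimately have "b = 0"
      by simp
    then show ?thesis
      using Ma u by simp
  qed
  ultimately show "spectral_subspace P M \<subseteq> {u. M *v u = w *s u}"
    unfolding spectral_subspace_def by (intro vec.span_minimal) auto
next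
  show "{u. M *v u = w *s u} \<subseteq> spectral_subspace P M"
  proof
    fix u assume "u \<in> {u. M *v u = w *s u}"
    then have "((\<lambda>y. (M - mat w) *v y) ^^ 1) u = 0"
      by (simp add: matrix_vector_mult_diff_rdistrib mat_mult_vector)
    then show "u \<in> spectral_subspace P M"
      unfolding spectral_subspace_def using \<open>P w\<close> by (intro vec.span_base) blast
  qed
qed

lemma columns_2: "columns (R :: 'a^2^'n) = {column 1 R, column 2 R}"
  by (auto simp: columns_def) (metis exhaust_2)

lemma span_pair:
  fixes a b :: "'a::field^'n"
  shows "vec.span {a, b} = {x. \<exists>s t. x = s *s a + t *s b}"
  unfolding vec.span_insert[of a] vec.span_singleton
  by (simp add: image_iff diff_eq_eq add.commute)

text \<open>\<open>V\<close> is the graph of a linear map from the first two coordinates to the last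
  two, so the identity block on top fixes both columns, as the definite description
  requires.\<close>

lemma normalized_basis_graph:
  assumes V: "V = {u. u $ 3 = a * u $ 1 + b * u $ 2 \<and> u $ 4 = c * u $ 1 + d * u $ 2}"
  shows "normalized_basis V =
    vector [vector [1, 0], vector [0, 1], vector [a, b], vector [c, d]]" (is "_ = ?R")
  unfolding normalized_basis_def
proof (rule the_equality)
  have cols: "columns ?R = {vector [1, 0, a, c], vector [0, 1, b, d]}"
    unfolding columns_2 by (simp add: column_def vec_eq_iff forall_4 insert_eq_iff)
  have span: "vec.span (columns ?R) = V"
    unfolding cols span_pair V by (auto simp: vec_eq_iff forall_4 mult.commute)
  have "vector [1, 0, a, c] \<notin> vec.span {vector [0, 1, b, d] :: complex^4}"
    by (auto simp: vec.span_singleton vec_eq_iff forall_4)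
  moreover have "vector [0, 1, b, d] \<noteq> (0 :: complex^4)"
    by (simp add: vec_eq_iff forall_4)
  ultimately have "vec.independent (columns ?R)"
    unfolding cols by (auto simp: vec.independent_insert vec.span_base)
  with span show "vec.independent (columns ?R) \<and> vec.span (columns ?R) = V \<and>
      ?R $ 1 $ 1 = 1 \<and> ?R $ 1 $ 2 = 0 \<and> ?R $ 2 $ 1 = 0 \<and> ?R $ 2 $ 2 = 1"
    by simp
next
  fix R :: "complex^2^4"
  assume R: "vec.independent (columns R) \<and> vec.span (columns R) = V \<and>
      R $ 1 $ 1 = 1 \<and> R $ 1 $ 2 = 0 \<and> R $ 2 $ 1 = 0 \<and> R $ 2 $ 2 = 1"
  then have "column 1 R \<in> V" "column 2 R \<in> V"
    by (auto simp: columns_2 intro: vec.span_base)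
  then show "R = ?R"
    using R by (simp add: V column_def vec_eq_iff forall_4 forall_2)
qed

lemma matrix_inv_eqI:
  fixes A :: "'a::semiring_1^'n^'m"
  assumes "A ** B = mat 1" "B ** A = mat 1"
  shows "matrix_inv A = B"
proof -
  have "A ** matrix_inv A = mat 1 \<and> matrix_inv A ** A = mat 1"
    unfolding matrix_inv_def by (rule someI[of _ B]) (use assms in simp)
  then show ?thesis
    by (metis assms(2) matrix_mul_assoc matrix_mul_lid matrix_mul_rid)
qed

section \<open>Derivatives of the Hadamard energy\<close>

lemma has_derivative_vec_nth [derivative_intros]:
  "(f has_derivative f') F \<Longrightarrow> ((\<lambda>x. f x $ i) has_derivative (\<lambda>x. f' x $ i)) F"
  by (rule bounded_linear.has_derivative[OF bounded_linear_vec_nth])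

definition hadamard_h' :: "real \<Rightarrow> real \<Rightarrow> real" where
  "hadamard_h' J\<^sub>0 J = ((J - J\<^sub>0)\<^sup>2 - 1) * (J - J\<^sub>0) / J\<^sub>0"

text \<open>For \<open>J\<^sub>0 > 0\<close> its zeros \<open>J\<^sub>0 - 1 / sqrt 3\<close> and
  \<open>J\<^sub>0 + 1 / sqrt 3\<close> are the determinants of the two phases. There
  \<open>hadamard_h'\<close>, which is odd about \<open>J\<^sub>0\<close>, takes opposite
  values.\<close>

definition hadamard_h'' :: "real \<Rightarrow> real \<Rightarrow> real" where
  "hadamard_h'' J\<^sub>0 J = (3 * (J - J\<^sub>0)\<^sup>2 - 1) / J\<^sub>0"

text \<open>Jacobi's formula: the inner product of \<open>G\<close> with the cofactor matrix of
  \<open>F\<close>.\<close>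

definition det_derivative :: "real^2^2 \<Rightarrow> real^2^2 \<Rightarrow> real" where
  "det_derivative F G = F$1$1 * G$2$2 + F$2$2 * G$1$1 - F$1$2 * G$2$1 - F$2$1 * G$1$2"

lemma has_derivative_det2:
  "(det has_derivative det_derivative F) (at (F :: real^2^2))"
  unfolding det_2[abs_def] det_derivative_def[abs_def]
  by (auto intro!: derivative_eq_intros simp: algebra_simps)

lemma has_real_derivative_hadamard_h:
  "(hadamard_h J\<^sub>0 has_real_derivative hadamard_h' J\<^sub>0 J) (at J)"
  unfolding hadamard_h_def[abs_def] hadamard_h'_def
  \<comment> \<open>For \<open>J\<^sub>0 = 0\<close> both functions are identically 0, by the
    convention for division by zero.\<close>
  by (cases "J\<^sub>0 = 0")
    (auto intro!: derivative_eq_intros simp: divide_simps power2_eq_square, simp_all add: algebra_simps)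

lemma has_real_derivative_hadamard_h':
  "(hadamard_h' J\<^sub>0 has_real_derivative hadamard_h'' J\<^sub>0 J) (at J)"
proof (cases "J\<^sub>0 = 0")
  case False
  then show ?thesis
    unfolding hadamard_h'_def[abs_def] hadamard_h''_def
    by (auto intro!: derivative_eq_intros simp: field_simps power2_eq_square)
qed (simp add: hadamard_h'_def[abs_def] hadamard_h''_def)

lemma has_derivative_compose_det:
  assumes "(h has_real_derivative d) (at (det F))"
  shows "((\<lambda>G. h (det G)) has_derivative (\<lambda>G. d * det_derivative F G)) (at (F :: real^2^2))"
  using has_derivative_compose[OF has_derivative_det2 assms[unfolded has_field_derivative_def]] .

lemmas has_derivative_h'_det [derivative_intros] =
  has_derivative_compose_det[OF has_real_derivative_hadamard_h']

lemma has_derivative_hadamard_energy: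
  "(hadamard_energy J\<^sub>0 \<mu> has_derivative
     (\<lambda>G. \<mu> * (F$1$1 * G$1$1 + F$1$2 * G$1$2 + F$2$1 * G$2$1 + F$2$2 * G$2$2)
        + hadamard_h' J\<^sub>0 (det F) * det_derivative F G)) (at F)"
  unfolding hadamard_energy_def[abs_def]
  by (auto simp: trace_def matrix_matrix_mult_def transpose_def sum_2 algebra_simps
      intro!: derivative_eq_intros has_derivative_compose_det[OF has_real_derivative_hadamard_h])

text \<open>The matrix multiplying \<open>hadamard_h'\<close> is the cofactor matrix of
  \<open>F\<close>, the gradient of the determinant.\<close>

lemma stress_hadamard_energy:
  "stress (hadamard_energy J\<^sub>0 \<mu>) F = \<mu> *\<^sub>R F +
     hadamard_h' J\<^sub>0 (det F) *\<^sub>R vector [vector [F$2$2, - F$2$1], vector [- F$1$2, F$1$1]]"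
  unfolding stress_def frechet_derivative_at[OF has_derivative_hadamard_energy, symmetric]
  by (simp add: vec_eq_iff forall_2 axis_def det_derivative_def)

lemma has_derivative_stress_entries:
  fixes F :: "real^2^2" and J\<^sub>0 \<mu> :: real
  defines "h' \<equiv> hadamard_h' J\<^sub>0 (det F)" and "h'' \<equiv> hadamard_h'' J\<^sub>0 (det F)"
  shows
    "((\<lambda>G. stress (hadamard_energy J\<^sub>0 \<mu>) G $1$1) has_derivative
       (\<lambda>G. \<mu> * G$1$1 + h' * G$2$2 + h'' * det_derivative F G * F$2$2)) (at F)"
    "((\<lambda>G. stress (hadamard_energy J\<^sub>0 \<mu>) G $1$2) has_derivative
       (\<lambda>G. \<mu> * G$1$2 - h' * G$2$1 - h'' * det_derivative F G * F$2$1)) (at F)"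
    "((\<lambda>G. stress (hadamard_energy J\<^sub>0 \<mu>) G $2$1) has_derivative
       (\<lambda>G. \<mu> * G$2$1 - h' * G$1$2 - h'' * det_derivative F G * F$1$2)) (at F)"
    "((\<lambda>G. stress (hadamard_energy J\<^sub>0 \<mu>) G $2$2) has_derivative
       (\<lambda>G. \<mu> * G$2$2 + h' * G$1$1 + h'' * det_derivative F G * F$1$1)) (at F)"
  unfolding stress_hadamard_energy h'_def h''_def
  by (auto intro!: derivative_eq_intros simp: algebra_simps)

text \<open>When h'' vanishes, the Hessian of the energy is \<mu> times the identity plus h' times
  the constant Hessian of the determinant, which couples only the entries 11 with 22 and 12 with
  21.\<close>

lemma elasticity_hadamard_diag:
  fixes a b J\<^sub>0 \<mu> :: real
  defines "F \<equiv> vector [vector [a, 0], vector [0, b]] :: real^2^2"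
  assumes "hadamard_h'' J\<^sub>0 (a * b) = 0"
  shows "elasticity (hadamard_energy J\<^sub>0 \<mu>) 1 1 F = mat \<mu>"
    and "elasticity (hadamard_energy J\<^sub>0 \<mu>) 2 1 F =
      vector [vector [0, hadamard_h' J\<^sub>0 (a * b)], vector [- hadamard_h' J\<^sub>0 (a * b), 0]]"
    and "elasticity (hadamard_energy J\<^sub>0 \<mu>) 1 2 F =
      vector [vector [0, - hadamard_h' J\<^sub>0 (a * b)], vector [hadamard_h' J\<^sub>0 (a * b), 0]]"
    and "elasticity (hadamard_energy J\<^sub>0 \<mu>) 2 2 F = mat \<mu>"
proof -
  have det: "det F = a * b"
    by (simp add: F_def det_2)
  have F: "F$1$1 = a" "F$1$2 = 0" "F$2$1 = 0" "F$2$2 = b"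
    by (simp_all add: F_def)
  note D = has_derivative_stress_entries[of J\<^sub>0 \<mu> F, THEN frechet_derivative_at, symmetric]
  show "elasticity (hadamard_energy J\<^sub>0 \<mu>) 1 1 F = mat \<mu>"
    "elasticity (hadamard_energy J\<^sub>0 \<mu>) 2 1 F =
      vector [vector [0, hadamard_h' J\<^sub>0 (a * b)], vector [- hadamard_h' J\<^sub>0 (a * b), 0]]"
    "elasticity (hadamard_energy J\<^sub>0 \<mu>) 1 2 F =
      vector [vector [0, - hadamard_h' J\<^sub>0 (a * b)], vector [hadamard_h' J\<^sub>0 (a * b), 0]]"
    "elasticity (hadamard_energy J\<^sub>0 \<mu>) 2 2 F = mat \<mu>"
    unfolding elasticity_def vec_eq_iff forall_2 by (simp_all add: D F det assms(2) axis_def mat_def det_derivative_def)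
qed

section \<open>The kinetic rule and its derivative with respect to a state\<close>

lemma kinetic_rule_expand:
  "kinetic_rule W (abeyaratne_knowles \<epsilon>) Um Up s n =
     W (fst Up) - W (fst Um)
     - (\<Sum>k\<in>UNIV. ((fst Up - fst Um) *v n) $ k
          * ((1/2) * ((stress W (fst Um) + stress W (fst Up)) *v n) $ k)) - \<epsilon> * s"
proof -
  \<comment> \<open>Moving the transpose across the inner product leaves the jump and the mean
    stress both applied to \<open>n\<close>.\<close>
  have "n \<bullet> (transpose A *v w) = (A *v n) \<bullet> w" for A :: "real^2^2" and w
    by (metis dot_lmul_matrix inner_commute transpose_matrix_vector)
  then show ?thesis
    unfolding kinetic_rule_def abeyaratne_knowles_def
    by (simp add: inner_vec_def scaleR_matrix_vector_assoc[symmetric] del: scaleR_matrix_vector_assoc)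
qed

lemma axis_nth_2: "axis (1::2) x $ 2 = (0 :: 'a::zero)" "axis (2::2) x $ 1 = (0 :: 'a::zero)"
  by (simp_all add: axis_def)

lemma kinetic_rule_e1:
  "kinetic_rule W (abeyaratne_knowles \<epsilon>) Um Up 0 (axis 1 1) =
     W (fst Up) - W (fst Um)
     - ((fst Up $1$1 - fst Um $1$1) * (stress W (fst Um) $1$1 + stress W (fst Up) $1$1)
      + (fst Up $2$1 - fst Um $2$1) * (stress W (fst Um) $2$1 + stress W (fst Up) $2$1)) / 2"
  by (simp add: kinetic_rule_expand sum_2 matrix_vector_mult_def axis_nth_2 field_simps)

lemma has_derivative_compose_fst:
  assumes "(f has_derivative f') (at (fst U))"
  shows "((\<lambda>U. f (fst U)) has_derivative (\<lambda>V. f' (fst V))) (at U)"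
  using has_derivative_compose[OF has_derivative_fst[OF has_derivative_ident] assms] .

text \<open>The kinetic rule sees a state only through its deformation gradient, so the velocity
  derivatives vanish.\<close>

lemma state_gradient_fst:
  assumes "(f has_derivative f') (at F)"
  shows "state_gradient (\<lambda>U. f (fst U)) (F, v) = vector
    [complex_of_real (f' (axis 1 (axis 1 1))), complex_of_real (f' (axis 2 (axis 1 1))),
     complex_of_real (f' (axis 1 (axis 2 1))), complex_of_real (f' (axis 2 (axis 2 1))), 0, 0]"
proof -
  have "f' 0 = 0"
    using assms has_derivative_bounded_linear linear_simps(3) by blast
  moreover have "((\<lambda>U. f (fst U)) has_derivative (\<lambda>V. f' (fst V))) (at (F, v))"
    using assms by (intro has_derivative_compose_fst) simp
  ultimately show ?thesis
    unfolding state_gradient_def by (simp add: frechet_derivative_at[symmetric])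
qed

section \<open>Invariant subspaces of the symbol\<close>

text \<open>Shape of the elasticity blocks at the two phases, where \<open>h''\<close> vanishes and \<open>e = h'\<close>.\<close>

definition decoupled_elasticity :: "(real^2^2 \<Rightarrow> real) \<Rightarrow> real^2^2 \<Rightarrow> real \<Rightarrow> real \<Rightarrow> bool" where
  "decoupled_elasticity W F \<mu> e \<longleftrightarrow>
     elasticity W 1 1 F = mat \<mu> \<and> elasticity W 2 2 F = mat \<mu> \<and>
     elasticity W 2 1 F = vector [vector [0, e], vector [- e, 0]] \<and>
     elasticity W 1 2 F = vector [vector [0, - e], vector [e, 0]]"

text \<open>If \<open>w\<close> satisfies the dispersion relation
  \<open>w\<^sup>2 = lam\<^sup>2 / \<mu> + \<xi>\<^sup>2\<close>, the columns span the eigenspace of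
  the symbol for \<open>w\<close>.\<close>

definition basis_matrix :: "real \<Rightarrow> real \<Rightarrow> real \<Rightarrow> complex \<Rightarrow> complex^2^4" where
  "basis_matrix \<mu> e \<xi> w = vector
     [vector [1, 0], vector [0, 1],
      vector [- \<mu> * w, \<i> * \<xi> * e], vector [- (\<i> * \<xi> * e), - \<mu> * w]]"

lemma map_matrix_mat: "map_matrix complex_of_real (mat x) = mat (complex_of_real x)"
  by (simp add: vec_eq_iff mat_def)

lemma map_matrix_vector_2:
  "map_matrix complex_of_real (vector [vector [a, b], vector [c, d]] :: real^2^2) =
     vector [vector [complex_of_real a, complex_of_real b],
             vector [complex_of_real c, complex_of_real d]]"
  by (simp add: vec_eq_iff forall_2)

lemma mat_nth_2:
  "(mat x :: 'a::zero^2^2) $ 1 = vector [x, 0]" "(mat x :: 'a::zero^2^2) $ 2 = vector [0, x]"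
  by (simp_all add: vec_eq_iff forall_2 mat_def)

lemma matrix_inv_mat:
  assumes "(x::complex) \<noteq> 0"
  shows "matrix_inv (mat x :: complex^2^2) = mat (1 / x)"
  by (rule matrix_inv_eqI)
    (use assms in \<open>simp_all add: vec_eq_iff forall_2 matrix_matrix_mult_def sum_2 mat_def\<close>)

text \<open>\<open>B\<^sub>1\<^sup>2\<close> and \<open>B\<^sub>2\<^sup>1\<close> are opposite
  multiples of a quarter turn, so their product is \<open>e\<^sup>2\<close> times the identity and
  the lower left block is scalar.\<close>

lemma M_matrix_decoupled:
  assumes "decoupled_elasticity W F \<mu> e" "\<mu> \<noteq> 0"
  shows "M_matrix W F lam \<xi> = vector
    [vector [0, \<i> * \<xi> * e / \<mu>, - 1 / \<mu>, 0],
     vector [- (\<i> * \<xi> * e / \<mu>), 0, 0, - 1 / \<mu>],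
     vector [\<xi>\<^sup>2 * e\<^sup>2 / \<mu> - lam\<^sup>2 - \<mu> * \<xi>\<^sup>2, 0, 0, - (\<i> * \<xi> * e / \<mu>)],
     vector [0, \<xi>\<^sup>2 * e\<^sup>2 / \<mu> - lam\<^sup>2 - \<mu> * \<xi>\<^sup>2, \<i> * \<xi> * e / \<mu>, 0]]"
  using assms unfolding M_matrix_def decoupled_elasticity_def
  by (simp add: map_matrix_mat map_matrix_vector_2 matrix_inv_mat block_row_def Let_def)
     (simp add: vec_eq_iff forall_4 forall_2 matrix_matrix_mult_def sum_2 mat_nth_2 power2_eq_square)

lemma K_matrix_decoupled:
  assumes "decoupled_elasticity W F \<mu> e" "\<mu> \<noteq> 0"
  shows "K_matrix W F lam \<xi> = vector
    [vector [0, \<i> * \<xi> * e / \<mu>, - 1 / \<mu>, 0],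
     vector [- (\<i> * \<xi> * e / \<mu>), 0, 0, - 1 / \<mu>],
     vector [- (\<i> * \<xi>), 0, 0, 0], vector [0, - (\<i> * \<xi>), 0, 0],
     vector [- lam, 0, 0, 0], vector [0, - lam, 0, 0]]"
  using assms unfolding K_matrix_def decoupled_elasticity_def
  by (simp add: map_matrix_mat map_matrix_vector_2 matrix_inv_mat block_row_def Let_def)
     (simp add: matrix_matrix_mult_def sum_2 mat_nth_2)

text \<open>The first two rows of the eigenvector equation determine the last two coordinates; the
  dispersion relation then makes the remaining rows hold.\<close>

lemma normalized_basis_spectral_subspace:
  assumes "decoupled_elasticity W F \<mu> e" "\<mu> \<noteq> 0"
    and w: "w\<^sup>2 = lam\<^sup>2 / \<mu> + complex_of_real (\<xi>\<^sup>2)" "w \<noteq> 0" "P w" "\<not> P (- w)"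
  shows "normalized_basis (spectral_subspace P (M_matrix W F lam \<xi>)) = basis_matrix \<mu> e \<xi> w"
proof -
  note M = M_matrix_decoupled[OF assms(1,2), of lam \<xi>]
  have lam: "lam\<^sup>2 = \<mu> * (w\<^sup>2 - complex_of_real (\<xi>\<^sup>2))"
    using w(1) \<open>\<mu> \<noteq> 0\<close> by (simp add: field_simps)
  have sq: "M_matrix W F lam \<xi> ** M_matrix W F lam \<xi> = mat (w\<^sup>2)"
    using \<open>\<mu> \<noteq> 0\<close> unfolding M lam
    by (simp add: vec_eq_iff forall_4 matrix_matrix_mult_def sum_4 mat_def field_simps power2_eq_square)
  have "M_matrix W F lam \<xi> *v u = w *s u \<longleftrightarrow>
      u $ 3 = - \<mu> * w * u $ 1 + \<i> * \<xi> * e * u $ 2 \<and> u $ 4 = - (\<i> * \<xi> * e) * u $ 1 + - \<mu> * w * u $ 2"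
    (is "?eig \<longleftrightarrow> ?g3 \<and> ?g4") for u
  proof
    assume ?eig
    then have "\<i> * \<xi> * e / \<mu> * u $ 2 - u $ 3 / \<mu> = w * u $ 1"
      "- (\<i> * \<xi> * e / \<mu> * u $ 1) - u $ 4 / \<mu> = w * u $ 2"
      unfolding M by (simp_all add: vec_eq_iff forall_4 matrix_vector_mult_def sum_4)
    then show "?g3 \<and> ?g4"
      using \<open>\<mu> \<noteq> 0\<close> by (simp add: field_simps)
  next
    assume "?g3 \<and> ?g4"
    then show ?eig
      using \<open>\<mu> \<noteq> 0\<close> unfolding M lam
      by (simp add: vec_eq_iff forall_4 matrix_vector_mult_def sum_4)
         (simp add: field_simps power2_eq_square)
  qed
  then show ?thesis
    unfolding spectral_subspace_of_scalar_square[where P = P, OF sq w(2-4)] basis_matrix_def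
    by (intro normalized_basis_graph) simp
qed

section \<open>Decay rate and extension to the boundary\<close>

text \<open>The factorisation \<open>(lam/\<surd>\<mu> + \<i>\<xi>) (lam/\<surd>\<mu> - \<i>\<xi>)\<close> of \<open>lam\<^sup>2/\<mu> + \<xi>\<^sup>2\<close> keeps both square roots
  away from the branch cut, so the product is continuous up to the imaginary axis of \<open>lam\<close>,
  which \<open>csqrt (lam\<^sup>2/\<mu> + \<xi>\<^sup>2)\<close> is not.\<close>

definition decay_rate :: "real \<Rightarrow> complex \<times> real \<Rightarrow> complex" where
  "decay_rate \<mu> p = csqrt (fst p / sqrt \<mu> + \<i> * snd p) * csqrt (fst p / sqrt \<mu> - \<i> * snd p)"

lemma decay_rate_squared:
  assumes "\<mu> > 0"
  shows "(decay_rate \<mu> (lam, \<xi>))\<^sup>2 = lam\<^sup>2 / \<mu> + complex_of_real (\<xi>\<^sup>2)"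
proof -
  have "complex_of_real (sqrt \<mu>) * complex_of_real (sqrt \<mu>) = \<mu>"
    using assms by (simp flip: of_real_mult)
  then show ?thesis
    using assms by (simp add: decay_rate_def power_mult_distrib) (simp add: power2_eq_square algebra_simps)
qed

text \<open>Re z is the difference of the squared real and imaginary parts of the root, and the
  principal root has nonnegative real part.\<close>

lemma abs_Im_csqrt_less_Re:
  assumes "Re z > 0"
  shows "\<bar>Im (csqrt z)\<bar> < Re (csqrt z)"
proof -
  have "(Im (csqrt z))\<^sup>2 < (Re (csqrt z))\<^sup>2"
    using assms power2_csqrt[of z] by (metis Re_power2 diff_gt_0_iff_gt)
  then show ?thesis
    using Re_csqrt[of z] abs_le_square_iff[of "Re (csqrt z)" "Im (csqrt z)"] by linarith
qed

text \<open>Both factors have arguments below \<pi>/4 in modulus, so the product stays in the open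
  right half plane.\<close>

lemma Re_decay_rate_pos:
  assumes "\<mu> > 0" "Re lam > 0"
  shows "Re (decay_rate \<mu> (lam, \<xi>)) > 0"
proof -
  have "Re (c * d) > 0" if "\<bar>Im c\<bar> < Re c" "\<bar>Im d\<bar> < Re d" for c d
  proof -
    have "\<bar>Im c\<bar> * \<bar>Im d\<bar> < Re c * Re d"
      using that by (intro mult_strict_mono') auto
    then show ?thesis
      using abs_ge_self[of "Im c * Im d"] by (simp add: abs_mult)
  qed
  then show ?thesis
    using assms unfolding decay_rate_def by (simp add: abs_Im_csqrt_less_Re del: csqrt.sel times_complex.sel)
qed

text \<open>The closed right half plane meets the branch cut only at 0, where the modulus of the
  root tends to 0.\<close>

lemma continuous_on_csqrt_halfspace: "continuous_on {z. Re z \<ge> 0} csqrt"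
  unfolding continuous_on_eq_continuous_within
proof
  fix z assume z: "z \<in> {z. Re z \<ge> 0}"
  show "continuous (at z within {z. Re z \<ge> 0}) csqrt"
  proof (cases "z = 0")
    case True
    have "cmod (csqrt x) < r" if "0 < r" "cmod x < r\<^sup>2" for r x
      using that by (auto simp: real_less_lsqrt)
    then show ?thesis
      unfolding True continuous_within_eps_delta using zero_less_power by (fastforce simp: dist_norm)
  next
    case False
    with z have "z \<notin> \<real>\<^sub>\<le>\<^sub>0"
      by (auto simp: complex_nonpos_Reals_iff complex_eq_iff)
    then show ?thesis
      by (rule continuous_within_csqrt)
  qed
qed

lemma continuous_on_decay_rate:
  assumes "\<mu> > 0"
  shows "continuous_on {p. Re (fst p) \<ge> 0} (decay_rate \<mu>)"
  unfolding decay_rate_def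
  by (intro continuous_intros continuous_on_compose2[OF continuous_on_csqrt_halfspace])
     (use assms in auto)

text \<open>For Re lam > 0, the imaginary part of the dispersion relation shows that Im w and Im lam
  do not have opposite signs; the imaginary axis follows by a limit. There the inequality records
  which root is meant.\<close>

lemma Re_decay_rate_cnj_nonneg:
  assumes "\<mu> > 0" "Re lam \<ge> 0"
  shows "Re (decay_rate \<mu> (lam, \<xi>) * cnj lam) \<ge> 0"
proof -
  have pos: "Re (decay_rate \<mu> (z, \<xi>) * cnj z) \<ge> 0" if "Re z > 0" for z
  proof -
    let ?w = "decay_rate \<mu> (z, \<xi>)"
    have w: "Re ?w > 0"
      using Re_decay_rate_pos assms(1) that .
    have "Im (?w\<^sup>2) = Im (z\<^sup>2 / \<mu> + complex_of_real (\<xi>\<^sup>2))"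
      using decay_rate_squared[OF assms(1)] by metis
    then have "Re ?w * Im ?w = Re z * Im z / \<mu>"
      by (simp add: Im_power2)
    then have "Re ?w * (Im ?w * Im z) = Re z * (Im z)\<^sup>2 / \<mu>"
      by (simp add: power2_eq_square field_simps)
    also have "\<dots> \<ge> 0"
      using assms that by simp
    finally have "Im ?w * Im z \<ge> 0"
      using w by (simp add: zero_le_mult_iff)
    then show ?thesis
      using w that by simp
  qed
  \<comment> \<open>Shifting \<open>lam\<close> by a positive real \<open>t\<close> enters the open
    half plane, where \<open>pos\<close> applies.\<close>
  let ?f = "\<lambda>t. Re (decay_rate \<mu> (lam + of_real t, \<xi>) * cnj (lam + of_real t))"
  have "continuous_on {0..} ?f"
    by (intro continuous_intros continuous_on_compose2[OF continuous_on_decay_rate[OF assms(1)]])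
      (use assms in auto)
  from bspec[OF this[unfolded continuous_on_def], of 0]
  have "(?f \<longlongrightarrow> ?f 0) (at 0 within {0..})"
    by simp
  then have "(?f \<longlongrightarrow> ?f 0) (at_right 0)"
    by (rule tendsto_within_subset) auto
  moreover have "\<forall>\<^sub>F t in at_right 0. ?f t \<ge> 0"
    using eventually_at_right_less[of 0] by (rule eventually_mono) (use assms(2) in \<open>intro pos; simp\<close>)
  ultimately have "?f 0 \<ge> 0"
    by (rule tendsto_lowerbound) simp
  then show ?thesis
    by simp
qed

text \<open>Makes the filter in \<open>extend_to_\<Gamma>\<close> nontrivial, so that its limit is
  unique.\<close>

lemma islimpt_\<Gamma>_plus:
  assumes "p \<in> \<Gamma>" "p \<notin> \<Gamma>_plus"
  shows "p islimpt \<Gamma>_plus"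
proof -
  obtain lam \<xi> where p: "p = (lam, \<xi>)"
    by fastforce
  have lam: "Re lam = 0" and norm: "(Im lam)\<^sup>2 + \<xi>\<^sup>2 = 1"
    using assms unfolding p \<Gamma>_plus_def \<Gamma>_def by (auto simp: cmod_power2)
  define t :: "nat \<Rightarrow> real" where "t n = inverse (Suc n)" for n
  \<comment> \<open>The boundary point is scaled by sqrt(1 - t^2) and given real part t, which keeps
    it on the unit sphere.\<close>
  define q where
    "q n = (Complex (t n) (Im lam * sqrt (1 - (t n)\<^sup>2)), \<xi> * sqrt (1 - (t n)\<^sup>2))" for n
  have t: "0 < t n" "(t n)\<^sup>2 \<le> 1" for n
    by (auto simp: t_def power_le_one divide_simps)
  have "(cmod (fst (q n)))\<^sup>2 + (snd (q n))\<^sup>2 = 1" for n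
  proof -
    have "(cmod (fst (q n)))\<^sup>2 + (snd (q n))\<^sup>2 = (t n)\<^sup>2 + ((Im lam)\<^sup>2 + \<xi>\<^sup>2) * (1 - (t n)\<^sup>2)"
      using t(2)[of n] by (simp add: q_def cmod_power2 power_mult_distrib algebra_simps)
    then show ?thesis
      unfolding norm by simp
  qed
  then have "q n \<in> \<Gamma>_plus - {p}" for n
    using t(1)[of n] lam unfolding \<Gamma>_plus_def \<Gamma>_def p by (auto simp: q_def complex_eq_iff)
  moreover have "t \<longlonglongrightarrow> 0"
    unfolding t_def by (rule LIMSEQ_inverse_real_of_nat)
  then have "q \<longlonglongrightarrow> (Complex 0 (Im lam * sqrt (1 - 0\<^sup>2)), \<xi> * sqrt (1 - 0\<^sup>2))"
    unfolding q_def by (intro tendsto_intros)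
  then have "q \<longlonglongrightarrow> p"
    using lam by (simp add: p) (metis complex_surj)
  ultimately show ?thesis
    unfolding islimpt_sequential by blast
qed

lemma extend_to_\<Gamma>_eq:
  fixes g :: "complex \<times> real \<Rightarrow> 'a::t2_space"
  assumes "\<And>p. p \<in> \<Gamma>_plus \<Longrightarrow> f p = g p" "continuous_on \<Gamma> g" "p \<in> \<Gamma>"
  shows "extend_to_\<Gamma> f p = g p"
proof (cases "p \<in> \<Gamma>_plus")
  case False
  have "(g \<longlongrightarrow> g p) (at p within \<Gamma>)"
    using assms(2,3) unfolding continuous_on_def by blast
  then have "(g \<longlongrightarrow> g p) (at p within \<Gamma>_plus)"
    by (rule tendsto_within_subset) (simp add: \<Gamma>_plus_def)
  then have "(f \<longlongrightarrow> g p) (at p within \<Gamma>_plus)"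
    by (rule Lim_transform_eventually) (simp add: eventually_at_filter assms(1))
  then have "Lim (at p within \<Gamma>_plus) f = g p"
    using islimpt_\<Gamma>_plus[OF assms(3) False] by (intro tendsto_Lim) (auto simp: trivial_limit_within)
  then show ?thesis
    using False by (simp add: extend_to_\<Gamma>_def)
qed (simp add: extend_to_\<Gamma>_def assms)

lemma continuous_on_componentwise_vec:
  "(\<And>i. continuous_on S (\<lambda>x. f x $ i)) \<Longrightarrow> continuous_on S f"
  unfolding continuous_on_def by (auto intro!: vec_tendstoI)

lemma continuous_on_basis_matrix:
  assumes "continuous_on S w" "continuous_on S \<xi>"
  shows "continuous_on S (\<lambda>p. basis_matrix \<mu> e (\<xi> p) (w p))"
proof (intro continuous_on_componentwise_vec)
  fix i :: 4 and j :: 2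
  show "continuous_on S (\<lambda>p. basis_matrix \<mu> e (\<xi> p) (w p) $ i $ j)"
    using exhaust_4[of i] exhaust_2[of j]
    by (elim disjE; simp add: basis_matrix_def; intro continuous_intros assms)
qed

text \<open>On \<open>\<Gamma>_plus\<close> the decay rate is the unstable eigenvalue and its
  negative the stable one. The formulas are continuous on all of \<open>\<Gamma>\<close>, so they
  persist even where the decay rate vanishes.\<close>

lemma R_decoupled:
  assumes "decoupled_elasticity W F \<mu> e" "\<mu> > 0" "(lam, \<xi>) \<in> \<Gamma>"
  shows "R_unstable W F (lam, \<xi>) = basis_matrix \<mu> e \<xi> (decay_rate \<mu> (lam, \<xi>))"
    and "R_stable W F (lam, \<xi>) = basis_matrix \<mu> e \<xi> (- decay_rate \<mu> (lam, \<xi>))"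
proof -
  have w: "continuous_on \<Gamma> (decay_rate \<mu>)"
    by (rule continuous_on_subset[OF continuous_on_decay_rate[OF assms(2)]]) (auto simp: \<Gamma>_def)
  have *: "normalized_basis (unstable_subspace (M_matrix W F l x)) = basis_matrix \<mu> e x (decay_rate \<mu> (l, x))"
    "normalized_basis (stable_subspace (M_matrix W F l x)) = basis_matrix \<mu> e x (- decay_rate \<mu> (l, x))"
    if "(l, x) \<in> \<Gamma>_plus" for l x
  proof -
    have "Re l > 0"
      using that by (simp add: \<Gamma>_plus_def)
    then have "Re (decay_rate \<mu> (l, x)) > 0"
      using Re_decay_rate_pos assms(2) by blast
    moreover from this have "decay_rate \<mu> (l, x) \<noteq> 0"
      by auto
    ultimately show "normalized_basis (unstable_subspace (M_matrix W F l x)) = basis_matrix \<mu> e x (decay_rate \<mu> (l, x))"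
      "normalized_basis (stable_subspace (M_matrix W F l x)) = basis_matrix \<mu> e x (- decay_rate \<mu> (l, x))"
      unfolding unstable_subspace_def stable_subspace_def
      using assms decay_rate_squared[OF assms(2)]
      by (intro normalized_basis_spectral_subspace; simp)+
  qed
  show "R_unstable W F (lam, \<xi>) = basis_matrix \<mu> e \<xi> (decay_rate \<mu> (lam, \<xi>))"
    unfolding R_unstable_def
    by (rule extend_to_\<Gamma>_eq[where g = "\<lambda>p. basis_matrix \<mu> e (snd p) (decay_rate \<mu> p)", OF _ _ assms(3), unfolded snd_conv])
      (auto simp: * intro!: continuous_on_basis_matrix continuous_intros w)
  show "R_stable W F (lam, \<xi>) = basis_matrix \<mu> e \<xi> (- decay_rate \<mu> (lam, \<xi>))"
    unfolding R_stable_def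
    by (rule extend_to_\<Gamma>_eq[where g = "\<lambda>p. basis_matrix \<mu> e (snd p) (- decay_rate \<mu> p)", OF _ _ assms(3), unfolded snd_conv])
      (auto simp: * intro!: continuous_on_basis_matrix continuous_intros w)
qed

section \<open>The Lopatinskii determinant\<close>

text \<open>The first two rows express the first two unknowns through the other three; substitution
  identifies the kernels of the two matrices.\<close>

lemma det_5_eq_0_iff:
  fixes q1 q2 :: "'a::field"
  shows "det (vector [vector [1, 0, q1, 1, 0], vector [0, 1, q2, 0, 1],
      vector [a1, a2, a3, a4, a5], vector [b1, b2, b3, b4, b5],
      vector [c1, c2, c3, c4, c5]] :: 'a^5^5) = 0 \<longleftrightarrow>
    det (vector [vector [a3 - q1 * a1 - q2 * a2, a4 - a1, a5 - a2],
      vector [b3 - q1 * b1 - q2 * b2, b4 - b1, b5 - b2],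
      vector [c3 - q1 * c1 - q2 * c2, c4 - c1, c5 - c2]] :: 'a^3^3) = 0"
    (is "det ?A = 0 \<longleftrightarrow> det ?B = 0")
  unfolding det_eq_0_iff_ker
proof
  assume "\<exists>x. x \<noteq> 0 \<and> ?A *v x = 0"
  then obtain x where x: "x \<noteq> 0" and Ax: "?A *v x = 0"
    by blast
  have 12: "x $ 1 = - q1 * x $ 3 - x $ 4" "x $ 2 = - q2 * x $ 3 - x $ 5"
    using Ax by (simp_all add: vec_eq_iff forall_5 matrix_vector_mult_def sum_5 eq_neg_iff_add_eq_0 algebra_simps)
  define y :: "'a^3" where "y = vector [x $ 3, x $ 4, x $ 5]"
  have "y \<noteq> 0"
    using x 12 by (auto simp: y_def vec_eq_iff forall_5 forall_3)
  moreover have "?B *v y = 0"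
    using Ax by (simp add: vec_eq_iff forall_5 forall_3 matrix_vector_mult_def sum_5 sum_3 y_def 12 algebra_simps)
  ultimately show "\<exists>y. y \<noteq> 0 \<and> ?B *v y = 0"
    by blast
next
  assume "\<exists>y. y \<noteq> 0 \<and> ?B *v y = 0"
  then obtain y where y: "y \<noteq> 0" and By: "?B *v y = 0"
    by blast
  define x :: "'a^5"
    where "x = vector [- q1 * y $ 1 - y $ 2, - q2 * y $ 1 - y $ 3, y $ 1, y $ 2, y $ 3]"
  have "x \<noteq> 0"
    using y by (auto simp: x_def vec_eq_iff forall_5 forall_3)
  moreover have "?A *v x = 0"
    using By by (simp add: vec_eq_iff forall_5 forall_3 matrix_vector_mult_def sum_5 sum_3 x_def algebra_simps)
  ultimately show "\<exists>x. x \<noteq> 0 \<and> ?A *v x = 0"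
    by blast
qed

section \<open>The jump conditions at a diagonal phase boundary\<close>

definition diag2 :: "real \<Rightarrow> real \<Rightarrow> real^2^2" where
  "diag2 a b = vector [vector [a, 0], vector [0, b]]"

lemma diag2_nth [simp]:
  "diag2 a b $ 1 $ 1 = a" "diag2 a b $ 1 $ 2 = 0" "diag2 a b $ 2 $ 1 = 0" "diag2 a b $ 2 $ 2 = b"
  by (simp_all add: diag2_def)

lemma det_diag2 [simp]: "det (diag2 a b) = a * b"
  by (simp add: det_2)

lemma stress_diag2:
  "stress (hadamard_energy J\<^sub>0 \<mu>) (diag2 a b) =
     diag2 (\<mu> * a + hadamard_h' J\<^sub>0 (a * b) * b) (\<mu> * b + hadamard_h' J\<^sub>0 (a * b) * a)"
  by (simp add: stress_hadamard_energy vec_eq_iff forall_2)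

lemma decoupled_elasticity_diag2:
  "hadamard_h'' J\<^sub>0 (a * b) = 0 \<Longrightarrow>
    decoupled_elasticity (hadamard_energy J\<^sub>0 \<mu>) (diag2 a b) \<mu> (hadamard_h' J\<^sub>0 (a * b))"
  unfolding decoupled_elasticity_def diag2_def by (simp add: elasticity_hadamard_diag)

text \<open>\<open>am\<close>, \<open>ap\<close> are the (1,1) entries of the two deformation gradients and \<open>b\<close> the common (2,2)
  entry.\<close>

locale hadamard_boundary =
  fixes J\<^sub>0 \<mu> \<epsilon> am ap b c :: real
  assumes \<mu>: "\<mu> > 0"
    and h'm: "hadamard_h' J\<^sub>0 (am * b) = c"
    and h'p: "hadamard_h' J\<^sub>0 (ap * b) = - c"
    and h''m: "hadamard_h'' J\<^sub>0 (am * b) = 0"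
    and h''p: "hadamard_h'' J\<^sub>0 (ap * b) = 0"
    and rankine_hugoniot: "\<mu> * am + c * b = \<mu> * ap - c * b"
begin

abbreviation "W \<equiv> hadamard_energy J\<^sub>0 \<mu>"
abbreviation "gt \<equiv> abeyaratne_knowles \<epsilon>"
abbreviation "Fm \<equiv> diag2 am b"
abbreviation "Fp \<equiv> diag2 ap b"
text \<open>Jump and mean of the (1,1) entry across the boundary; this \<open>s\<close> is not the
  speed.\<close>

abbreviation "f \<equiv> ap - am"
abbreviation "s \<equiv> (ap + am) / 2"

lemma decoupled: "decoupled_elasticity W Fm \<mu> c" "decoupled_elasticity W Fp \<mu> (- c)"
  using decoupled_elasticity_diag2 h''m h''p h'm h'p by metis+

lemma stress_boundary:
  "stress W Fm = diag2 (\<mu> * am + c * b) (\<mu> * b + c * am)"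
  "stress W Fp = diag2 (\<mu> * am + c * b) (\<mu> * b - c * ap)"
  by (simp_all add: stress_diag2 h'm h'p rankine_hugoniot)

text \<open>As the (1,1) stress is continuous, its contributions cancel in the 11 direction and only
  the derivative \<mu> of the averaged stress remains. In the 22 direction that derivative replaces
  \<open>ap\<close> by the mean \<open>s\<close>.\<close>

lemma state_gradient_plus:
  "state_gradient (\<lambda>U. kinetic_rule W gt (Fm, 0) U 0 (axis 1 1)) (Fp, 0) =
     vector [- (\<mu> * f / 2), 0, 0, \<mu> * b - c * s, 0, 0]"
proof -
  let ?S = "stress W"
  have "b * c = \<mu> * f / 2"
    using rankine_hugoniot by (simp add: field_simps)
  \<comment> \<open>The trailing factor lets the simplifier eliminate \<open>b * c\<close> inside
    longer products.\<close>
  then have rh: "b * (c * x) = \<mu> * f / 2 * x" for x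
    by (metis mult.assoc)
  have "((\<lambda>F. W F - W Fm - ((F$1$1 - Fm$1$1) * (?S Fm $1$1 + ?S F $1$1)
      + (F$2$1 - Fm$2$1) * (?S Fm $2$1 + ?S F $2$1)) / 2) has_derivative
    (\<lambda>G. - \<mu> * f / 2 * G$1$1 + (\<mu> * b - c * s) * G$2$2)) (at Fp)"
    by (rule has_derivative_stress_entries has_derivative_hadamard_energy derivative_eq_intros
          refl zero_neq_numeral[symmetric])+
      (simp add: fun_eq_iff stress_boundary h'p h''p det_derivative_def rh field_simps)
  from state_gradient_fst[OF this] show ?thesis
    unfolding kinetic_rule_e1 by (simp add: axis_def)
qed

lemma state_gradient_minus:
  "state_gradient (\<lambda>U. kinetic_rule W gt U (Fp, 0) 0 (axis 1 1)) (Fm, 0) =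
     vector [- (\<mu> * f / 2), 0, 0, - (\<mu> * b + c * s), 0, 0]"
proof -
  let ?S = "stress W"
  have "b * c = \<mu> * f / 2"
    using rankine_hugoniot by (simp add: field_simps)
  then have rh: "b * (c * x) = \<mu> * f / 2 * x" for x
    by (metis mult.assoc)
  have "((\<lambda>F. W Fp - W F - ((Fp$1$1 - F$1$1) * (?S F $1$1 + ?S Fp $1$1)
      + (Fp$2$1 - F$2$1) * (?S F $2$1 + ?S Fp $2$1)) / 2) has_derivative
    (\<lambda>G. - \<mu> * f / 2 * G$1$1 - (\<mu> * b + c * s) * G$2$2)) (at Fm)"
    by (rule has_derivative_stress_entries has_derivative_hadamard_energy derivative_eq_intros
          refl zero_neq_numeral[symmetric])+
      (simp add: fun_eq_iff stress_boundary h'm h''m det_derivative_def rh field_simps)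
  from state_gradient_fst[OF this] show ?thesis
    unfolding kinetic_rule_e1 by (simp add: axis_def)
qed

text \<open>The jump of \<open>F\<close> has only a (1,1) entry and the stresses are diagonal, so
  the rule depends on the normal through \<open>n $ 1\<close> squared, whose derivative along the
  second axis is zero.\<close>

lemma q_hat_boundary:
  fixes lam :: complex
  shows "q_hat W gt Fm Fp lam \<xi> = \<epsilon> * lam"
proof -
  let ?g = "kinetic_rule W gt (Fm, 0) (Fp, 0)"
  have g: "?g t n = W Fp - W Fm - f * (\<mu> * am + c * b) * (n $ 1 * n $ 1) - \<epsilon> * t" for t n
    by (simp add: kinetic_rule_expand sum_2 matrix_vector_mult_def stress_boundary algebra_simps)
  have "((\<lambda>t. ?g t (axis 1 1)) has_real_derivative - \<epsilon>) (at 0)"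
    unfolding g by (auto intro!: derivative_eq_intros)
  then have "deriv (\<lambda>t. ?g t (axis 1 1)) 0 = - \<epsilon>"
    by (rule DERIV_imp_deriv)
  moreover have "((\<lambda>n :: real^2. C - K * (n $ 1 * n $ 1)) has_derivative (\<lambda>v. - K * (2 * v $ 1)))
      (at (axis 1 1))" for C K
    by (auto intro!: derivative_eq_intros simp: axis_def)
  then have "(?g 0 has_derivative (\<lambda>v. - (f * (\<mu> * am + c * b)) * (2 * v $ 1))) (at (axis 1 1))"
    by (simp add: g[abs_def] del: mult_minus_left)
  then have "normal_gradient (?g 0) (axis 1 1) $ 2 = 0"
    unfolding normal_gradient_def by (simp add: frechet_derivative_at[symmetric] axis_nth_2)
  ultimately show ?thesis
    unfolding q_hat_def Let_def by (simp add: inner_axis' )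
qed

lemma Q_hat_boundary: "Q_hat W Fm Fp \<xi> = vector [f, 0, 0, 2 * \<i> * \<xi> * c * s]"
  unfolding Q_hat_def Let_def
  by (simp add: column_def stress_boundary vec_eq_iff forall_4 field_simps)

context
  fixes lam \<xi>
  assumes \<Gamma>: "(lam, \<xi>) \<in> \<Gamma>"
begin

abbreviation "w \<equiv> decay_rate \<mu> (lam, \<xi>)"

lemma p_plus_boundary:
  "p_plus W gt Fm Fp lam \<xi> = vector [- (\<mu> * f / 2 * w), - (\<i> * \<xi> * (\<mu> * b - c * s))]"
  unfolding p_plus_def state_gradient_plus R_decoupled(1)[OF decoupled(2) \<mu> \<Gamma>]
  using \<mu> by (simp add: K_matrix_decoupled[OF decoupled(2)] vec_eq_iff forall_2 basis_matrix_def
      vector_matrix_mult_def matrix_matrix_mult_def sum_6 sum_4)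

lemma p_minus_boundary:
  "p_minus W gt Fm Fp lam \<xi> = vector [- (\<mu> * f / 2 * w), - (\<i> * \<xi> * (\<mu> * b + c * s))]"
  unfolding p_minus_def state_gradient_minus R_decoupled(2)[OF decoupled(1) \<mu> \<Gamma>]
  using \<mu> by (simp add: K_matrix_decoupled[OF decoupled(1)] vec_eq_iff forall_2 basis_matrix_def
      vector_matrix_mult_def matrix_matrix_mult_def sum_6 sum_4) (simp add: field_simps)

text \<open>In the reduced 3 x 3 determinant the difference of the lower blocks of the two bases has
  determinant \<open>4 * (\<mu>\<^sup>2 * w\<^sup>2 - c\<^sup>2 * \<xi>\<^sup>2)\<close>, and the
  difference of the \<open>p\<close> rows is \<open>(0, 2 * \<i> * \<xi> * c * s)\<close>.\<close>

lemma lopatinskii_eq_0_iff: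
  "lopatinskii_determinant W gt Fm Fp (lam, \<xi>) = 0 \<longleftrightarrow>
     (\<epsilon> * lam + \<mu> * f\<^sup>2 / 2 * w) * (\<mu>\<^sup>2 * w\<^sup>2 - c\<^sup>2 * \<xi>\<^sup>2) = 2 * \<mu> * (c * s)\<^sup>2 * \<xi>\<^sup>2 * w"
proof -
  have "lopatinskii_determinant W gt Fm Fp (lam, \<xi>) = 0 \<longleftrightarrow>
    4 * ((\<epsilon> * lam + \<mu> * f\<^sup>2 / 2 * w) * (\<mu>\<^sup>2 * w\<^sup>2 - c\<^sup>2 * \<xi>\<^sup>2) - 2 * \<mu> * (c * s)\<^sup>2 * \<xi>\<^sup>2 * w) = 0"
    unfolding lopatinskii_determinant_def prod.case Let_def p_plus_boundary p_minus_boundary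
      q_hat_boundary Q_hat_boundary R_decoupled(1)[OF decoupled(2) \<mu> \<Gamma>]
      R_decoupled(2)[OF decoupled(1) \<mu> \<Gamma>] basis_matrix_def vector_2 vector_4 det_5_eq_0_iff det_3 vector_3
    by (rule arg_cong[where f = "\<lambda>x. x = 0"]) (simp add: field_simps power2_eq_square)
  then show ?thesis
    by (simp only: mult_eq_0_iff right_minus_eq) simp
qed

end
end

section \<open>Zeros of the Lopatinskii determinant\<close>

text \<open>With \<open>p = w cnj lam\<close> and \<open>r = (\<mu> lam\<^sup>2 + B \<xi>\<^sup>2) cnj (\<mu> lam\<^sup>2 + A \<xi>\<^sup>2)\<close>, a zero forces \<open>p r \<le> 0\<close>;
  but \<open>Re p > 0\<close> and the imaginary parts of \<open>p\<close> and \<open>r\<close> have opposite signs.\<close>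

lemma no_zero_in_open_halfplane:
  fixes lam w :: complex and \<epsilon> k \<mu> A B \<xi> :: real
  assumes "\<epsilon> > 0" "k > 0" "\<mu> > 0" "0 \<le> B" "B < A"
    and w2: "w\<^sup>2 = lam\<^sup>2 / \<mu> + complex_of_real (\<xi>\<^sup>2)" and Rw: "Re w > 0" and Rl: "Re lam > 0"
  shows "\<epsilon> * lam * (\<mu> * lam\<^sup>2 + A * \<xi>\<^sup>2) + k * w * (\<mu> * lam\<^sup>2 + B * \<xi>\<^sup>2) \<noteq> 0"
proof
  assume eq: "\<epsilon> * lam * (\<mu> * lam\<^sup>2 + A * \<xi>\<^sup>2) + k * w * (\<mu> * lam\<^sup>2 + B * \<xi>\<^sup>2) = 0"
  define z where "z = lam\<^sup>2"
  define p where "p = w * cnj lam"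
  define r where "r = (\<mu> * z + B * \<xi>\<^sup>2) * cnj (\<mu> * z + A * \<xi>\<^sup>2)"
  \<comment> \<open>Multiplying the equation by the conjugate of the cofactor of \<epsilon> turns
    that summand into a nonnegative real number.\<close>
  have "k * (p * r) = (k * w * (\<mu> * lam\<^sup>2 + B * \<xi>\<^sup>2)) * (cnj lam * cnj (\<mu> * z + A * \<xi>\<^sup>2))"
    by (simp add: p_def r_def z_def)
  also have "\<dots> = - (\<epsilon> * lam * (\<mu> * z + A * \<xi>\<^sup>2)) * (cnj lam * cnj (\<mu> * z + A * \<xi>\<^sup>2))"
    using eq by (simp only: z_def add_eq_0_iff2) (simp add: eq_neg_iff_add_eq_0)
  also have "\<dots> = - (\<epsilon> * ((lam * cnj lam) * ((\<mu> * z + A * \<xi>\<^sup>2) * cnj (\<mu> * z + A * \<xi>\<^sup>2))))"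
    by (simp only: ac_simps minus_mult_left)
  also have "\<dots> = complex_of_real (- (\<epsilon> * ((cmod lam)\<^sup>2 * (cmod (\<mu> * z + A * \<xi>\<^sup>2))\<^sup>2)))"
    by (simp only: complex_norm_square[symmetric] of_real_mult of_real_minus of_real_power)
  finally have kpr: "complex_of_real k * (p * r) =
      complex_of_real (- (\<epsilon> * ((cmod lam)\<^sup>2 * (cmod (\<mu> * z + A * \<xi>\<^sup>2))\<^sup>2)))" .
  have "k * Im (p * r) = 0"
    using arg_cong[OF kpr, of Im] by simp
  then have Im_pr: "Re p * Im r + Im p * Re r = 0"
    using \<open>k > 0\<close> by simp
  have "k * Re (p * r) \<le> 0"
    using arg_cong[OF kpr, of Re] \<open>\<epsilon> > 0\<close> by simp
  then have Re_pr: "Re p * Re r - Im p * Im r \<le> 0"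
    using \<open>k > 0\<close> by (simp add: mult_le_0_iff)
  have "Re w * Im w = Re lam * Im lam / \<mu>"
    using arg_cong[OF w2, of Im] by (simp add: Im_power2)
  then have "Re w * (Im w * Im lam) = Re lam * (Im lam)\<^sup>2 / \<mu>"
    by (simp add: power2_eq_square field_simps)
  also have "\<dots> \<ge> 0"
    using Rl \<open>\<mu> > 0\<close> by simp
  finally have "Im w * Im lam \<ge> 0"
    using Rw by (simp add: zero_le_mult_iff)
  then have Rp: "Re p > 0"
    using mult_pos_pos[OF Rw Rl] by (simp add: p_def)
  have "p\<^sup>2 = (lam * cnj lam)\<^sup>2 / \<mu> + \<xi>\<^sup>2 * cnj z"
    unfolding p_def power_mult_distrib w2 by (simp add: z_def field_simps)
  also have "\<dots> = complex_of_real ((cmod lam) ^ 4 / \<mu>) + \<xi>\<^sup>2 * cnj z"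
    by (simp add: complex_norm_square[symmetric] flip: power_mult)
  finally have "p\<^sup>2 = complex_of_real ((cmod lam) ^ 4 / \<mu>) + \<xi>\<^sup>2 * cnj z" .
  \<comment> \<open>Source of the sign relation: the only nonreal term of the square of
    \<open>p\<close> is a multiple of \<open>cnj z\<close>.\<close>
  from arg_cong[OF this, of Im] have Im_p2: "2 * Re p * Im p = - \<xi>\<^sup>2 * Im z"
    by (simp add: Im_power2 del: of_real_divide of_real_power)
  have "2 * Re p * (Im p * Im z) = (2 * Re p * Im p) * Im z"
    by simp
  also have "\<dots> = - (\<xi>\<^sup>2 * (Im z)\<^sup>2)"
    unfolding Im_p2 by (simp add: power2_eq_square)
  also have "\<dots> \<le> 0"
    by simp
  finally have pz: "Im p * Im z \<le> 0"
    using Rp by (simp add: mult_le_0_iff)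
  have Ir: "Im r = \<mu> * (A - B) * \<xi>\<^sup>2 * Im z"
    by (simp add: r_def algebra_simps)
  have "Im p * Im r = \<mu> * (A - B) * \<xi>\<^sup>2 * (Im p * Im z)"
    by (simp add: Ir)
  also have "\<dots> \<le> 0"
    using pz \<open>\<mu> > 0\<close> \<open>B < A\<close> by - (rule mult_nonneg_nonpos, simp_all)
  finally have pr: "Im p * Im r \<le> 0" .
  have "Re r > 0"
  proof (cases "Im r = 0")
    case True
    then consider "\<xi> = 0" | "Im z = 0"
      using \<open>\<mu> > 0\<close> \<open>B < A\<close> by (auto simp: Ir)
    then show ?thesis
    proof cases
      case 1
      have "z \<noteq> 0"
        using Rl by (auto simp: z_def)
      have "r = (\<mu> * z) * cnj (\<mu> * z)"
        by (simp add: r_def 1)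
      also have "\<dots> = complex_of_real ((cmod (\<mu> * z))\<^sup>2)"
        by (rule complex_norm_square[symmetric])
      finally have "Re r = (cmod (\<mu> * z))\<^sup>2"
        by (simp only: Re_complex_of_real)
      then show ?thesis
        using \<open>z \<noteq> 0\<close> \<open>\<mu> > 0\<close> by simp
    next
      case 2
      then have "Im lam = 0"
        using Rl by (simp add: z_def Im_power2)
      then have "Re z > 0"
        using Rl by (simp add: z_def Re_power2)
      then show ?thesis
        using 2 assms(3-5) by (simp add: r_def add_pos_nonneg)
    qed
  next
    case False
    \<comment> \<open>\<open>Im_pr\<close> multiplied by \<open>Im r\<close>; the left side is
      positive and \<open>- (Im p * Im r)\<close> is nonnegative, which forces the sign of
      \<open>Re r\<close>.\<close>
    have "Re p * (Im r)\<^sup>2 = - (Im p * Im r) * Re r"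
      using Im_pr by (simp add: power2_eq_square) algebra
    moreover have "Re p * (Im r)\<^sup>2 > 0"
      using Rp False by simp
    ultimately have pos: "- (Im p * Im r) * Re r > 0"
      by metis
    show ?thesis
    proof (rule ccontr)
      assume "\<not> Re r > 0"
      then have "- (Im p * Im r) * Re r \<le> 0"
        using pr by (intro mult_nonneg_nonpos) simp_all
      with pos show False
        by (meson not_le)
    qed
  qed
  then show False
    using Re_pr pr Rp mult_pos_pos[of "Re p" "Re r"] by linarith
qed

text \<open>For \<open>lam = \<i> * t\<close> the square of \<open>w\<close> is real. If
  \<open>w\<close> is real and nonzero, the summands are imaginary and real and must vanish
  separately, impossible as \<open>A\<close> and \<open>B\<close> differ. If \<open>w\<close> is
  imaginary, \<open>t\<close> is nonzero, both brackets are negative and \<open>wl\<close> prevents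
  the summands from cancelling.\<close>

lemma no_zero_on_imaginary_axis:
  fixes lam w :: complex and \<epsilon> k \<mu> A B \<xi> :: real
  assumes "\<epsilon> > 0" "k > 0" "\<mu> > 0" "0 < B" "B < A" "A < \<mu>\<^sup>2"
    and w2: "w\<^sup>2 = lam\<^sup>2 / \<mu> + complex_of_real (\<xi>\<^sup>2)"
    and wl: "Re (w * cnj lam) \<ge> 0" and lam: "Re lam = 0" and nz: "lam \<noteq> 0 \<or> \<xi> \<noteq> 0"
  shows "\<epsilon> * lam * (\<mu> * lam\<^sup>2 + A * \<xi>\<^sup>2) + k * w * (\<mu> * lam\<^sup>2 + B * \<xi>\<^sup>2) \<noteq> 0"
proof
  assume eq: "\<epsilon> * lam * (\<mu> * lam\<^sup>2 + A * \<xi>\<^sup>2) + k * w * (\<mu> * lam\<^sup>2 + B * \<xi>\<^sup>2) = 0"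
  define t where "t = Im lam"
  have lt: "lam = \<i> * t"
    using lam by (simp add: t_def complex_eq_iff)
  have nz': "t \<noteq> 0 \<or> \<xi> \<noteq> 0"
    using nz lt by auto
  have eqR: "k * Re w * (B * \<xi>\<^sup>2 - \<mu> * t\<^sup>2) = 0"
    using arg_cong[OF eq, of Re] by (simp add: lt power_mult_distrib)
  have eqI: "\<epsilon> * t * (A * \<xi>\<^sup>2 - \<mu> * t\<^sup>2) + k * Im w * (B * \<xi>\<^sup>2 - \<mu> * t\<^sup>2) = 0"
    using arg_cong[OF eq, of Im] by (simp add: lt power_mult_distrib)
  have "(Re w)\<^sup>2 - (Im w)\<^sup>2 = \<xi>\<^sup>2 - t\<^sup>2 / \<mu>"
    using arg_cong[OF w2, of Re] by (simp add: lt power_mult_distrib Re_power2)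
  then have "t\<^sup>2 = \<mu> * (\<xi>\<^sup>2 + (Im w)\<^sup>2 - (Re w)\<^sup>2)"
    using \<open>\<mu> > 0\<close> by (simp add: field_simps)
  then have w2R: "\<mu> * t\<^sup>2 = \<mu>\<^sup>2 * (\<xi>\<^sup>2 + (Im w)\<^sup>2 - (Re w)\<^sup>2)"
    by (simp add: power2_eq_square)
  have "Re w * Im w = 0"
    using arg_cong[OF w2, of Im] by (simp add: lt power_mult_distrib Im_power2)
  then consider "Im w = 0" "Re w \<noteq> 0" | "Re w = 0"
    by auto
  then show False
  proof cases
    case 1
    then have B: "B * \<xi>\<^sup>2 = \<mu> * t\<^sup>2" and A: "t = 0 \<or> A * \<xi>\<^sup>2 = \<mu> * t\<^sup>2"
      using eqR eqI assms(1,2) by auto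
    show False
    proof (cases "t = 0")
      case True
      then show False
        using B nz' \<open>0 < B\<close> by simp
    next
      case False
      then have "A * \<xi>\<^sup>2 = B * \<xi>\<^sup>2"
        using A B by simp
      then have "\<xi> = 0"
        using \<open>B < A\<close> by simp
      then show False
        using B False \<open>\<mu> > 0\<close> by simp
    qed
  next
    case 2
    have mt: "\<mu> * t\<^sup>2 = \<mu>\<^sup>2 * \<xi>\<^sup>2 + \<mu>\<^sup>2 * (Im w)\<^sup>2"
      using w2R 2 by (simp add: algebra_simps)
    have t: "t \<noteq> 0"
      using mt nz' \<open>\<mu> > 0\<close> by (auto simp: add_nonneg_eq_0_iff)
    have neg: "C * \<xi>\<^sup>2 - \<mu> * t\<^sup>2 < 0" if "C < \<mu>\<^sup>2" for C
    proof (cases "\<xi> = 0")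
      case False
      then have "C * \<xi>\<^sup>2 < \<mu>\<^sup>2 * \<xi>\<^sup>2"
        using that by simp
      moreover have "0 \<le> \<mu>\<^sup>2 * (Im w)\<^sup>2"
        by simp
      ultimately show ?thesis
        unfolding mt by linarith
    qed (use t \<open>\<mu> > 0\<close> in simp)
    have "Im w * t \<ge> 0"
      using wl by (simp add: lt)
    then have "k * (Im w * t) * (B * \<xi>\<^sup>2 - \<mu> * t\<^sup>2) \<le> 0"
      using neg[of B] assms(2,5,6) by (intro mult_nonneg_nonpos) auto
    moreover have "\<epsilon> * t\<^sup>2 * (A * \<xi>\<^sup>2 - \<mu> * t\<^sup>2) < 0"
      using neg[of A] assms(1,6) t by (intro mult_pos_neg) auto
    moreover have "\<epsilon> * t\<^sup>2 * (A * \<xi>\<^sup>2 - \<mu> * t\<^sup>2) + k * (Im w * t) * (B * \<xi>\<^sup>2 - \<mu> * t\<^sup>2) =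
        t * (\<epsilon> * t * (A * \<xi>\<^sup>2 - \<mu> * t\<^sup>2) + k * Im w * (B * \<xi>\<^sup>2 - \<mu> * t\<^sup>2))"
      by (simp add: algebra_simps power2_eq_square)
    ultimately show False
      unfolding eqI by simp
  qed
qed

lemma decay_rate_of_real:
  assumes "\<mu> > 0" "t > 0"
  shows "decay_rate \<mu> (complex_of_real t, \<xi>) = complex_of_real (sqrt (t\<^sup>2 / \<mu> + \<xi>\<^sup>2))"
proof -
  let ?w = "decay_rate \<mu> (complex_of_real t, \<xi>)" and ?r = "sqrt (t\<^sup>2 / \<mu> + \<xi>\<^sup>2)"
  have nonneg: "t\<^sup>2 / \<mu> + \<xi>\<^sup>2 \<ge> 0"
    using assms by simp
  have "?w\<^sup>2 = (complex_of_real ?r)\<^sup>2"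
    using assms decay_rate_squared[OF assms(1), of t \<xi>] by (simp flip: of_real_power)
  then have "?w = ?r \<or> ?w = - complex_of_real ?r"
    by (simp add: power2_eq_iff)
  moreover have "Re ?w > 0"
    using Re_decay_rate_pos[OF assms(1)] assms(2) by simp
  ultimately show ?thesis
    using nonneg by auto
qed

text \<open>On the quarter circle \<open>\<xi> = sqrt (1 - t\<^sup>2)\<close> the expression equals
  \<open>k * B < 0\<close> at \<open>t = 0\<close> and is positive at \<open>t = 1\<close>.\<close>

lemma zero_in_open_halfplane:
  fixes \<epsilon> k \<mu> A B :: real
  assumes "\<epsilon> > 0" "k > 0" "\<mu> > 0" "B < 0"
  obtains t \<xi> :: real where "(complex_of_real t, \<xi>) \<in> \<Gamma>_plus"
    and "\<epsilon> * t * (\<mu> * t\<^sup>2 + A * \<xi>\<^sup>2) + k * sqrt (t\<^sup>2 / \<mu> + \<xi>\<^sup>2) * (\<mu> * t\<^sup>2 + B * \<xi>\<^sup>2) = 0"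
proof -
  define g where "g t = \<epsilon> * t * (\<mu> * t\<^sup>2 + A * (1 - t\<^sup>2))
    + k * sqrt (t\<^sup>2 / \<mu> + (1 - t\<^sup>2)) * (\<mu> * t\<^sup>2 + B * (1 - t\<^sup>2))" for t
  have "g 0 < 0"
    using assms by (simp add: g_def mult_pos_neg)
  moreover have "g 1 > 0"
    using assms by (simp add: g_def add_pos_pos)
  moreover have "continuous_on {0..1} g"
    unfolding g_def using assms by (intro continuous_intros) auto
  ultimately obtain t where t: "0 \<le> t" "t \<le> 1" "g t = 0"
    using IVT'[of g 0 0 1] by auto
  with \<open>g 0 < 0\<close> have "t > 0"
    by (cases "t = 0") auto
  define \<xi> where "\<xi> = sqrt (1 - t\<^sup>2)"
  have \<xi>: "\<xi>\<^sup>2 = 1 - t\<^sup>2"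
    using t by (simp add: \<xi>_def power_le_one)
  have "(complex_of_real t, \<xi>) \<in> \<Gamma>_plus"
    using \<open>t > 0\<close> \<xi> by (simp add: \<Gamma>_plus_def \<Gamma>_def)
  moreover have "\<epsilon> * t * (\<mu> * t\<^sup>2 + A * \<xi>\<^sup>2) + k * sqrt (t\<^sup>2 / \<mu> + \<xi>\<^sup>2) * (\<mu> * t\<^sup>2 + B * \<xi>\<^sup>2) = 0"
    using \<open>g t = 0\<close> by (simp add: g_def \<xi>)
  ultimately show ?thesis
    using that by blast
qed

text \<open>Here \<mu>/2 times the squared jump is \<open>k\<close>, and \<open>c\<close> times the
  mean is a third of the jump; together they produce the constant 4/9. The dispersion relation and
  the value of \<open>c\<^sup>2\<close> produce \<open>A\<close>.\<close>

lemma lopatinskii_hadamard_eq_0_iff: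
  fixes J\<^sub>0 \<mu> \<epsilon> \<xi> :: real and lam :: complex
  defines "A \<equiv> \<mu>\<^sup>2 - 4 / (27 * J\<^sub>0\<^sup>2)" and "k \<equiv> 2 * \<mu> / (3 * theta0 J\<^sub>0 \<mu>)"
  assumes "J\<^sub>0 > 0" "\<mu> > 0" and \<Gamma>: "(lam, \<xi>) \<in> \<Gamma>"
  shows "lopatinskii_determinant (hadamard_energy J\<^sub>0 \<mu>) (abeyaratne_knowles \<epsilon>)
      (F_minus J\<^sub>0 \<mu>) (F_plus J\<^sub>0 \<mu>) (lam, \<xi>) = 0 \<longleftrightarrow>
    \<epsilon> * lam * (\<mu> * lam\<^sup>2 + A * \<xi>\<^sup>2)
      + k * decay_rate \<mu> (lam, \<xi>) * (\<mu> * lam\<^sup>2 + (A - 4 / 9) * \<xi>\<^sup>2) = 0"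
proof -
  define b where "b = sqrt (theta0 J\<^sub>0 \<mu>)"
  define am where "am = (J\<^sub>0 - 1 / sqrt 3) * (1 / b)"
  define ap where "ap = (J\<^sub>0 + 1 / sqrt 3) * (1 / b)"
  \<comment> \<open>The value of \<open>hadamard_h'\<close> at the determinant
    \<open>J\<^sub>0 - 1 / sqrt 3\<close> of the minus phase.\<close>
  define c where "c = 2 / (3 * sqrt 3 * J\<^sub>0)"
  have b: "b > 0" "b\<^sup>2 = 3 * \<mu> * J\<^sub>0 / 2"
    using assms by (simp_all add: b_def theta0_def)
  have ab: "am * b = J\<^sub>0 - 1 / sqrt 3" "ap * b = J\<^sub>0 + 1 / sqrt 3"
    using b by (simp_all add: am_def ap_def)
  have f: "ap - am = 2 / (sqrt 3 * b)"
    using b by (simp add: am_def ap_def field_simps)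
  \<comment> \<open>The Rankine-Hugoniot condition, which holds because \<open>b\<^sup>2\<close> is
    the chosen \<open>theta0\<close>.\<close>
  have cb: "2 * c * b = \<mu> * (ap - am)"
  proof -
    have "2 * c * b * b = \<mu> * (2 / sqrt 3)"
      using assms b(2) by (simp add: c_def power2_eq_square field_simps)
    then show ?thesis
      using b(1) by (simp add: f field_simps)
  qed
  interpret hadamard_boundary J\<^sub>0 \<mu> \<epsilon> am ap b c
  proof
    show "\<mu> * am + c * b = \<mu> * ap - c * b"
      using cb by (simp add: algebra_simps)
    show "hadamard_h' J\<^sub>0 (am * b) = c" "hadamard_h' J\<^sub>0 (ap * b) = - c"
      "hadamard_h'' J\<^sub>0 (am * b) = 0" "hadamard_h'' J\<^sub>0 (ap * b) = 0"
      unfolding ab hadamard_h'_def hadamard_h''_def using assms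
      by (simp_all add: c_def power_divide)
  qed (use assms in simp)
  have FF: "F_minus J\<^sub>0 \<mu> = diag2 am b" "F_plus J\<^sub>0 \<mu> = diag2 ap b"
    by (simp_all add: F_minus_def F_plus_def diag2_def am_def ap_def b_def)
  have c2: "c\<^sup>2 = 4 / (27 * J\<^sub>0\<^sup>2)"
    by (simp add: c_def power_divide power_mult_distrib)
  have "(ap - am)\<^sup>2 = 4 / (3 * b\<^sup>2)"
    by (simp add: f power_divide power_mult_distrib)
  then have k: "\<mu> * (ap - am)\<^sup>2 / 2 = k"
    using b by (simp add: k_def b(2) theta0_def)
  have cs: "c * ((ap + am) / 2) = (ap - am) / 3"
    using assms b(1) by (simp add: f am_def ap_def c_def field_simps)
  have R: "2 * \<mu> * (c * ((ap + am) / 2))\<^sup>2 * \<xi>\<^sup>2 = 4 / 9 * k * \<xi>\<^sup>2"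
    unfolding cs by (simp add: power_divide flip: k)
  have "lopatinskii_determinant W gt Fm Fp (lam, \<xi>) = 0 \<longleftrightarrow>
      (\<epsilon> * lam + k * decay_rate \<mu> (lam, \<xi>)) * (\<mu>\<^sup>2 * (decay_rate \<mu> (lam, \<xi>))\<^sup>2 - c\<^sup>2 * \<xi>\<^sup>2)
        = complex_of_real (4 / 9 * k * \<xi>\<^sup>2) * decay_rate \<mu> (lam, \<xi>)"
    unfolding lopatinskii_eq_0_iff[OF \<Gamma>] k R by simp
  also have "\<mu>\<^sup>2 * (decay_rate \<mu> (lam, \<xi>))\<^sup>2 - c\<^sup>2 * \<xi>\<^sup>2 = \<mu> * lam\<^sup>2 + A * \<xi>\<^sup>2"
    unfolding decay_rate_squared[OF assms(4)] c2 A_def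
    using assms(4) by (simp add: field_simps power2_eq_square)
  finally show ?thesis
    unfolding FF eq_iff_diff_eq_0[of "_ * _"] by (simp add: algebra_simps)
qed

theorem theorem6p6:
  fixes J\<^sub>0 \<mu> \<delta>\<^sub>1 \<mu>\<^sub>s :: real
  assumes "J\<^sub>0 > 1" and "\<mu> > 0"
    and "\<delta>\<^sub>1 = 1 - 4 / (27 * J\<^sub>0\<^sup>2 * \<mu>\<^sup>2) - 4 / (9 * \<mu>\<^sup>2)"
    and "\<mu>\<^sub>s = 2 / 3 * sqrt (1 + 1 / (3 * J\<^sub>0\<^sup>2))"
  shows "((\<mu> > \<mu>\<^sub>s \<longleftrightarrow> \<delta>\<^sub>1 > 0) \<and>
          (\<mu> > \<mu>\<^sub>s \<longrightarrow> (\<forall>\<epsilon>>0. uniformly_stable (hadamard_energy J\<^sub>0 \<mu>)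
             (abeyaratne_knowles \<epsilon>) (F_minus J\<^sub>0 \<mu>) (F_plus J\<^sub>0 \<mu>)))) \<and>
         ((\<mu> = \<mu>\<^sub>s \<longleftrightarrow> \<delta>\<^sub>1 = 0) \<and>
          (\<mu> = \<mu>\<^sub>s \<longrightarrow> (\<forall>\<epsilon>>0. weakly_stable (hadamard_energy J\<^sub>0 \<mu>)
             (abeyaratne_knowles \<epsilon>) (F_minus J\<^sub>0 \<mu>) (F_plus J\<^sub>0 \<mu>)))) \<and>
         ((0 < \<mu> \<and> \<mu> < \<mu>\<^sub>s \<longleftrightarrow> \<delta>\<^sub>1 < 0) \<and>
          (0 < \<mu> \<and> \<mu> < \<mu>\<^sub>s \<longrightarrow> (\<forall>\<epsilon>>0. strongly_unstable (hadamard_energy J\<^sub>0 \<mu>)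
             (abeyaratne_knowles \<epsilon>) (F_minus J\<^sub>0 \<mu>) (F_plus J\<^sub>0 \<mu>))))"
proof -
  define A where "A = \<mu>\<^sup>2 - 4 / (27 * J\<^sub>0\<^sup>2)"
  define k where "k = 2 * \<mu> / (3 * theta0 J\<^sub>0 \<mu>)"
  let ?\<Delta> = "\<lambda>\<epsilon>. lopatinskii_determinant (hadamard_energy J\<^sub>0 \<mu>) (abeyaratne_knowles \<epsilon>)
      (F_minus J\<^sub>0 \<mu>) (F_plus J\<^sub>0 \<mu>)"
  have J\<^sub>0: "J\<^sub>0 > 0"
    using assms(1) by simp
  have k: "k > 0"
    using assms(1,2) by (simp add: k_def theta0_def)
  have A: "A - 4 / 9 < A" "A < \<mu>\<^sup>2"
    using assms(1) by (simp_all add: A_def)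
  have \<mu>s: "\<mu>\<^sub>s > 0" "\<mu>\<^sub>s\<^sup>2 = 4 / 9 + 4 / (27 * J\<^sub>0\<^sup>2)"
    using assms(1) by (simp_all add: assms(4) power_mult_distrib power_divide algebra_simps add_pos_nonneg)
  \<comment> \<open>The sign of this coefficient separates the three cases; it is also the sign of
    \<open>\<delta>\<^sub>1\<close>.\<close>
  have AB: "A - 4 / 9 = \<mu>\<^sup>2 - \<mu>\<^sub>s\<^sup>2"
    by (simp add: A_def \<mu>s)
  have \<delta>: "\<delta>\<^sub>1 = (\<mu>\<^sup>2 - \<mu>\<^sub>s\<^sup>2) / \<mu>\<^sup>2"
    using assms(1,2) by (simp add: assms(3) \<mu>s field_simps)
  have "\<mu>\<^sup>2 - \<mu>\<^sub>s\<^sup>2 = (\<mu> - \<mu>\<^sub>s) * (\<mu> + \<mu>\<^sub>s)"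
    by (simp add: power2_eq_square algebra_simps)
  then have sgn: "\<mu> > \<mu>\<^sub>s \<longleftrightarrow> \<mu>\<^sup>2 - \<mu>\<^sub>s\<^sup>2 > 0" "\<mu> = \<mu>\<^sub>s \<longleftrightarrow> \<mu>\<^sup>2 - \<mu>\<^sub>s\<^sup>2 = 0"
    "\<mu> < \<mu>\<^sub>s \<longleftrightarrow> \<mu>\<^sup>2 - \<mu>\<^sub>s\<^sup>2 < 0"
    using assms(2) \<mu>s(1) by (auto simp: zero_less_mult_iff mult_less_0_iff)
  note iff = lopatinskii_hadamard_eq_0_iff[OF J\<^sub>0 assms(2), folded A_def k_def]
  \<comment> \<open>Shared by (i) and (ii): the open half plane allows a zero coefficient.\<close>
  have open_half: "?\<Delta> \<epsilon> p \<noteq> 0" if "p \<in> \<Gamma>_plus" "\<epsilon> > 0" "A - 4 / 9 \<ge> 0" for \<epsilon> p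
  proof -
    obtain lam \<xi> where p: "p = (lam, \<xi>)"
      by fastforce
    have "Re lam > 0" "(lam, \<xi>) \<in> \<Gamma>"
      using that(1) by (simp_all add: p \<Gamma>_plus_def)
    then show ?thesis
      unfolding p using iff no_zero_in_open_halfplane[OF that(2) k assms(2) that(3) A(1)
        decay_rate_squared[OF assms(2)] Re_decay_rate_pos[OF assms(2)]] by blast
  qed
  have "uniformly_stable (hadamard_energy J\<^sub>0 \<mu>) (abeyaratne_knowles \<epsilon>) (F_minus J\<^sub>0 \<mu>) (F_plus J\<^sub>0 \<mu>)"
    if "\<mu> > \<mu>\<^sub>s" "\<epsilon> > 0" for \<epsilon>
    unfolding uniformly_stable_def
  proof
    fix p assume p: "p \<in> \<Gamma>"
    have B: "A - 4 / 9 > 0"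
      using that(1) sgn AB by simp
    show "?\<Delta> \<epsilon> p \<noteq> 0"
    proof (cases "p \<in> \<Gamma>_plus")
      case True
      then show ?thesis
        using open_half that(2) B by simp
    next
      case False
      obtain lam \<xi> where p': "p = (lam, \<xi>)"
        by fastforce
      have lam: "Re lam = 0" "lam \<noteq> 0 \<or> \<xi> \<noteq> 0" "Re lam \<ge> 0"
        using p False by (auto simp: p' \<Gamma>_plus_def \<Gamma>_def)
      show ?thesis
        unfolding p' using iff p no_zero_on_imaginary_axis[OF that(2) k assms(2) B A
            decay_rate_squared[OF assms(2)] Re_decay_rate_cnj_nonneg[OF assms(2) lam(3)] lam(1,2)]
        by (simp add: p')
    qed
  qed
  moreover have "weakly_stable (hadamard_energy J\<^sub>0 \<mu>) (abeyaratne_knowles \<epsilon>) (F_minus J\<^sub>0 \<mu>) (F_plus J\<^sub>0 \<mu>)"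
    if "\<mu> = \<mu>\<^sub>s" "\<epsilon> > 0" for \<epsilon>
    unfolding weakly_stable_def using open_half that sgn AB by simp
  moreover have "strongly_unstable (hadamard_energy J\<^sub>0 \<mu>) (abeyaratne_knowles \<epsilon>) (F_minus J\<^sub>0 \<mu>) (F_plus J\<^sub>0 \<mu>)"
    if less: "\<mu> < \<mu>\<^sub>s" and eps: "\<epsilon> > 0" for \<epsilon>
  proof -
    have "A - 4 / 9 < 0"
      using less sgn AB by simp
    then obtain t \<xi> where t: "(complex_of_real t, \<xi>) \<in> \<Gamma>_plus"
      "\<epsilon> * t * (\<mu> * t\<^sup>2 + A * \<xi>\<^sup>2) + k * sqrt (t\<^sup>2 / \<mu> + \<xi>\<^sup>2) * (\<mu> * t\<^sup>2 + (A - 4 / 9) * \<xi>\<^sup>2) = 0"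
      using zero_in_open_halfplane[OF eps k assms(2)] by metis
    have "t > 0" "(complex_of_real t, \<xi>) \<in> \<Gamma>"
      using t(1) by (simp_all add: \<Gamma>_plus_def)
    then have "?\<Delta> \<epsilon> (complex_of_real t, \<xi>) = 0"
      using iff[of t \<xi> \<epsilon>] arg_cong[OF t(2), of complex_of_real] assms(2)
      by (simp add: decay_rate_of_real)
    then show ?thesis
      unfolding strongly_unstable_def using t(1) by blast
  qed
  moreover have "\<delta>\<^sub>1 > 0 \<longleftrightarrow> \<mu>\<^sup>2 - \<mu>\<^sub>s\<^sup>2 > 0" "\<delta>\<^sub>1 = 0 \<longleftrightarrow> \<mu>\<^sup>2 - \<mu>\<^sub>s\<^sup>2 = 0" "\<delta>\<^sub>1 < 0 \<longleftrightarrow> \<mu>\<^sup>2 - \<mu>\<^sub>s\<^sup>2 < 0"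
    unfolding \<delta> using assms(2) by (simp_all add: zero_less_divide_iff divide_less_0_iff)
  ultimately show ?thesis
    using sgn assms(2) by auto
qed

end
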